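(* The functor $\Pi_1\colon\mathsf{Graph}\to\mathsf{Gpd}$ is strict monoidal (from $(\mathsf{Graph},\square,I_0)$ to $(\mathsf{Gpd},\times,\ast)$). In particular, for any two graphs $X$ and $Y$, the functors $\Psi_{X,Y}\colon\Pi_1(X\square Y)\to\Pi_1X\times\Pi_1Y$ and $\Phi_{X,Y}\colon\Pi_1X\times\Pi_1Y\to\Pi_1(X\square Y)$ are inverse to each other.
   Context: Graphs are simple undirected graphs without loops; a graph map $f\colon X\to Y$ is a vertex function such that adjacent vertices go to equal or adjacent vertices; $\mathsf{Graph}$ is the resulting category and $\mathsf{Gpd}$ the category of small groupoids. $I_n$ ($n\in\mathbb{N}$) has vertices $0,\dots,n$ and edges $i\sim i+1$. The box product $X\square Y$ has vertex set $V(X)\times V(Y)$, with $(x,y)\sim(x',y')$ iff either $x\sim x'$ and $y=y'$, or $x=x'$ and $y\sim y'$; $I_0$ is its unit. A path $\gamma\colon x\rightsquigarrow x'$ of length $n$ is a graph map $\gamma\colon I_n\to X$ with $\gamma(0)=x,\gamma(n)=x'$; concatenation $\gamma\ast\sigma$ of $\gamma$ (length $m$) and $\sigma\colon x'\rightsquigarrow x''$ (length $n$) is the path of length $m+n$ equal to $\gamma(i)$ for $i\le m$ and $\sigma(i-m)$ for $i\ge m$; the reverse is $\overline{\gamma}(i)=\gamma(n-i)$. A shrinking map is a surjective order-preserving graph map $I_m\to I_n$. $P_nX(x,x')$ is the graph whose vertices are paths of length $n$ from $x$ to $x'$, with $\gamma\sim\sigma$ iff $\gamma\ne\sigma$ and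 $\gamma(i)=\sigma(i)$ or $\gamma(i)\sim\sigma(i)$ for all $i$. $P_{\mathbb{N}}X(x,x')$ is the quotient of $\coprod_{n\in\mathbb{N}}P_nX(x,x')$ by the equivalence relation generated by $\gamma\sim\gamma\circ s$ for shrinking maps $s$ (quotient graph: classes as vertices, distinct classes adjacent iff some representatives are). $\pi_0$ denotes the set of path-components. The fundamental groupoid $\Pi_1X$ has objects the vertices of $X$, morphisms $\Pi_1X(x,x')=\pi_0P_{\mathbb{N}}X(x,x')$, composition $[\sigma]\circ[\gamma]=[\gamma\ast\sigma]$, inverses $[\overline\gamma]$; a graph map $f$ induces $[\gamma]\mapsto[f\circ\gamma]$. $\Psi_{X,Y}$ has components $\Pi_1$ of the projections $X\square Y\to X$, $X\square Y\to Y$, i.e. $[\gamma]\mapsto([\pi_X\gamma],[\pi_Y\gamma])$. $\Phi_{X,Y}$ sends a morphism $([\sigma],[\tau])\colon(x,y)\to(x',y')$ to $[(\sigma\square y)\ast(x'\square\tau)]$, where $(\sigma\square y)(i)=(\sigma(i),y)$ and $(x'\square\tau)(j)=(x',\tau(j))$.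
   Formalization: "Strict monoidal" is read as: the structure functors Φ (inverse Ψ) and the unit functor are isomorphisms, Φ and Ψ the identity on objects, natural and coherent; literal equality Π₁(X□Y)=Π₁X×Π₁Y fails, since morphisms are path classes on one side and pairs on the other. *)

theory Defs
  imports Main "HOL-Library.FuncSet"
begin

section \<open>Graphs\<close>

record 'a pregraph =
  verts :: "'a set"
  adj :: "'a \<Rightarrow> 'a \<Rightarrow> bool"

definition simple_graph :: "'a pregraph \<Rightarrow> bool" where
  "simple_graph X \<longleftrightarrow>
     (\<forall>x y. adj X x y \<longrightarrow> x \<in> verts X \<and> y \<in> verts X \<and> x \<noteq> y \<and> adj X y x)"

text \<open>A graph map is an extensional function (value \<^term>\<open>undefined\<close> outside the vertex set), so
  that HOL equality of graph maps is equality of vertex functions. Identities, composites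
  and paths follow the same convention.\<close>

definition graph_map :: "'a pregraph \<Rightarrow> 'b pregraph \<Rightarrow> ('a \<Rightarrow> 'b) \<Rightarrow> bool" where
  "graph_map X Y f \<longleftrightarrow>
     f \<in> verts X \<rightarrow>\<^sub>E verts Y \<and>
     (\<forall>x y. adj X x y \<longrightarrow> f x = f y \<or> adj Y (f x) (f y))"

definition graph_id :: "'a pregraph \<Rightarrow> 'a \<Rightarrow> 'a" where
  "graph_id X = (\<lambda>x\<in>verts X. x)"

definition graph_comp :: "'a pregraph \<Rightarrow> ('b \<Rightarrow> 'c) \<Rightarrow> ('a \<Rightarrow> 'b) \<Rightarrow> 'a \<Rightarrow> 'c" where
  "graph_comp X g f = compose (verts X) g f"

definition interval :: "nat \<Rightarrow> nat pregraph" where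
  "interval n = \<lparr>verts = {..n},
     adj = (\<lambda>i j. i \<le> n \<and> j \<le> n \<and> (j = i + 1 \<or> i = j + 1))\<rparr>"

definition box :: "'a pregraph \<Rightarrow> 'b pregraph \<Rightarrow> ('a \<times> 'b) pregraph" (infixr \<open>\<box>\<close> 70) where
  "X \<box> Y = \<lparr>verts = verts X \<times> verts Y,
     adj = (\<lambda>(x, y) (x', y').
        (adj X x x' \<and> y = y' \<and> y \<in> verts Y) \<or> (x = x' \<and> x \<in> verts X \<and> adj Y y y'))\<rparr>"

definition box_map ::
  "'a pregraph \<Rightarrow> 'b pregraph \<Rightarrow> ('a \<Rightarrow> 'c) \<Rightarrow> ('b \<Rightarrow> 'd) \<Rightarrow> 'a \<times> 'b \<Rightarrow> 'c \<times> 'd" where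
  "box_map X Y f g = (\<lambda>(x, y)\<in>verts (X \<box> Y). (f x, g y))"

definition box_fst :: "'a pregraph \<Rightarrow> 'b pregraph \<Rightarrow> 'a \<times> 'b \<Rightarrow> 'a" where
  "box_fst X Y = restrict fst (verts (X \<box> Y))"

definition box_snd :: "'a pregraph \<Rightarrow> 'b pregraph \<Rightarrow> 'a \<times> 'b \<Rightarrow> 'b" where
  "box_snd X Y = restrict snd (verts (X \<box> Y))"

definition box_assoc ::
  "'a pregraph \<Rightarrow> 'b pregraph \<Rightarrow> 'c pregraph \<Rightarrow> ('a \<times> 'b) \<times> 'c \<Rightarrow> 'a \<times> ('b \<times> 'c)" where
  "box_assoc X Y Z = (\<lambda>((x, y), z)\<in>verts ((X \<box> Y) \<box> Z). (x, (y, z)))"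

definition box_lunit :: "'a pregraph \<Rightarrow> nat \<times> 'a \<Rightarrow> 'a" where
  "box_lunit X = restrict snd (verts (interval 0 \<box> X))"

definition box_runit :: "'a pregraph \<Rightarrow> 'a \<times> nat \<Rightarrow> 'a" where
  "box_runit X = restrict fst (verts (X \<box> interval 0))"


section \<open>Path graphs and path components\<close>

definition path_graph :: "nat \<Rightarrow> 'a pregraph \<Rightarrow> 'a \<Rightarrow> 'a \<Rightarrow> (nat \<Rightarrow> 'a) pregraph" where
  "path_graph n X x x' =
     (let P = {\<gamma>. graph_map (interval n) X \<gamma> \<and> \<gamma> 0 = x \<and> \<gamma> n = x'}
      in \<lparr>verts = P,
          adj = (\<lambda>\<gamma> \<sigma>. \<gamma> \<in> P \<and> \<sigma> \<in> P \<and> \<gamma> \<noteq> \<sigma> \<and>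
                   (\<forall>i\<le>n. \<gamma> i = \<sigma> i \<or> adj X (\<gamma> i) (\<sigma> i)))\<rparr>)"

definition connected_rel :: "'a pregraph \<Rightarrow> ('a \<times> 'a) set" where
  "connected_rel X = {(x, x'). \<exists>n. verts (path_graph n X x x') \<noteq> {}}"

definition pi0 :: "'a pregraph \<Rightarrow> 'a set set" where
  "pi0 X = verts X // connected_rel X"

definition generated_equiv :: "'a set \<Rightarrow> ('a \<Rightarrow> 'a \<Rightarrow> bool) \<Rightarrow> ('a \<times> 'a) set" where
  "generated_equiv A r = {(a, b). a \<in> A \<and> b \<in> A \<and> equivclp r a b}"

definition quotient_graph :: "'a pregraph \<Rightarrow> ('a \<times> 'a) set \<Rightarrow> 'a set pregraph" where
  "quotient_graph X R = \<lparr>verts = verts X // R,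
     adj = (\<lambda>A B. A \<in> verts X // R \<and> B \<in> verts X // R \<and> A \<noteq> B \<and>
              (\<exists>a\<in>A. \<exists>b\<in>B. adj X a b))\<rparr>"

definition shrinking :: "nat \<Rightarrow> nat \<Rightarrow> (nat \<Rightarrow> nat) \<Rightarrow> bool" where
  "shrinking m n s \<longleftrightarrow>
     graph_map (interval m) (interval n) s \<and>
     s ` verts (interval m) = verts (interval n) \<and> mono_on (verts (interval m)) s"

text \<open>A path of unspecified length is a pair of its length and its underlying graph map; these
  pairs are the vertices of the coproduct of the path graphs.\<close>

type_synonym 'a path = "nat \<times> (nat \<Rightarrow> 'a)"

definition coprod_path_graph :: "'a pregraph \<Rightarrow> 'a \<Rightarrow> 'a \<Rightarrow> 'a path pregraph" where
  "coprod_path_graph X x x' =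
     \<lparr>verts = (SIGMA n:UNIV. verts (path_graph n X x x')),
      adj = (\<lambda>(m, \<gamma>) (n, \<sigma>). m = n \<and> adj (path_graph n X x x') \<gamma> \<sigma>)\<rparr>"

abbreviation paths :: "'a pregraph \<Rightarrow> 'a \<Rightarrow> 'a \<Rightarrow> 'a path set" where
  "paths X x x' \<equiv> verts (coprod_path_graph X x x')"

definition shrink_step :: "'a pregraph \<Rightarrow> 'a \<Rightarrow> 'a \<Rightarrow> 'a path \<Rightarrow> 'a path \<Rightarrow> bool" where
  "shrink_step X x x' p q \<longleftrightarrow> p \<in> paths X x x' \<and>
     (\<exists>s. shrinking (fst q) (fst p) s \<and> snd q = graph_comp (interval (fst q)) (snd p) s)"

definition shrink_equiv :: "'a pregraph \<Rightarrow> 'a \<Rightarrow> 'a \<Rightarrow> ('a path \<times> 'a path) set" where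
  "shrink_equiv X x x' = generated_equiv (paths X x x') (shrink_step X x x')"

definition path_graph_N :: "'a pregraph \<Rightarrow> 'a \<Rightarrow> 'a \<Rightarrow> 'a path set pregraph" where
  "path_graph_N X x x' = quotient_graph (coprod_path_graph X x x') (shrink_equiv X x x')"

definition path_const :: "'a \<Rightarrow> 'a path" where
  "path_const x = (0, \<lambda>i\<in>verts (interval 0). x)"

definition path_concat :: "'a path \<Rightarrow> 'a path \<Rightarrow> 'a path" (infixr \<open>\<star>\<close> 65) where
  "p \<star> q = (fst p + fst q,
     \<lambda>i\<in>verts (interval (fst p + fst q)). if i \<le> fst p then snd p i else snd q (i - fst p))"

definition path_reverse :: "'a path \<Rightarrow> 'a path" where
  "path_reverse p = (fst p, \<lambda>i\<in>verts (interval (fst p)). snd p (fst p - i))"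

definition path_map :: "('a \<Rightarrow> 'b) \<Rightarrow> 'a path \<Rightarrow> 'b path" where
  "path_map f p = (fst p, graph_comp (interval (fst p)) f (snd p))"


section \<open>Groupoids and functors\<close>

text \<open>Groupoids are given by hom-families: \<open>Comp G x y z g f\<close> is the composite of
  \<open>f : x \<rightarrow> y\<close> with \<open>g : y \<rightarrow> z\<close>, and \<open>Inv G x y f\<close> is the inverse of \<open>f : x \<rightarrow> y\<close>.\<close>

record ('o, 'm) gpd =
  Ob :: "'o set"
  Hom :: "'o \<Rightarrow> 'o \<Rightarrow> 'm set"
  Ident :: "'o \<Rightarrow> 'm"
  Comp :: "'o \<Rightarrow> 'o \<Rightarrow> 'o \<Rightarrow> 'm \<Rightarrow> 'm \<Rightarrow> 'm"
  Inv :: "'o \<Rightarrow> 'o \<Rightarrow> 'm \<Rightarrow> 'm"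

definition groupoid :: "('o, 'm) gpd \<Rightarrow> bool" where
  "groupoid G \<longleftrightarrow>
     (\<forall>x\<in>Ob G. Ident G x \<in> Hom G x x) \<and>
     (\<forall>x\<in>Ob G. \<forall>y\<in>Ob G. \<forall>z\<in>Ob G. \<forall>f\<in>Hom G x y. \<forall>g\<in>Hom G y z.
        Comp G x y z g f \<in> Hom G x z) \<and>
     (\<forall>x\<in>Ob G. \<forall>y\<in>Ob G. \<forall>f\<in>Hom G x y.
        Comp G x x y f (Ident G x) = f \<and> Comp G x y y (Ident G y) f = f) \<and>
     (\<forall>w\<in>Ob G. \<forall>x\<in>Ob G. \<forall>y\<in>Ob G. \<forall>z\<in>Ob G.
        \<forall>f\<in>Hom G w x. \<forall>g\<in>Hom G x y. \<forall>h\<in>Hom G y z.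
        Comp G w x z (Comp G x y z h g) f = Comp G w y z h (Comp G w x y g f)) \<and>
     (\<forall>x\<in>Ob G. \<forall>y\<in>Ob G. \<forall>f\<in>Hom G x y.
        Inv G x y f \<in> Hom G y x \<and>
        Comp G x y x (Inv G x y f) f = Ident G x \<and>
        Comp G y x y f (Inv G x y f) = Ident G y)"

record ('o, 'm, 'p, 'n) fctr =
  fobj :: "'o \<Rightarrow> 'p"
  farr :: "'o \<Rightarrow> 'o \<Rightarrow> 'm \<Rightarrow> 'n"

definition is_functor :: "('o, 'm) gpd \<Rightarrow> ('p, 'n) gpd \<Rightarrow> ('o, 'm, 'p, 'n) fctr \<Rightarrow> bool" where
  "is_functor G H F \<longleftrightarrow>
     (\<forall>x\<in>Ob G. fobj F x \<in> Ob H) \<and>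
     (\<forall>x\<in>Ob G. \<forall>y\<in>Ob G. \<forall>f\<in>Hom G x y. farr F x y f \<in> Hom H (fobj F x) (fobj F y)) \<and>
     (\<forall>x\<in>Ob G. farr F x x (Ident G x) = Ident H (fobj F x)) \<and>
     (\<forall>x\<in>Ob G. \<forall>y\<in>Ob G. \<forall>z\<in>Ob G. \<forall>f\<in>Hom G x y. \<forall>g\<in>Hom G y z.
        farr F x z (Comp G x y z g f) =
        Comp H (fobj F x) (fobj F y) (fobj F z) (farr F y z g) (farr F x y f))"

text \<open>Object and arrow maps of functors are total HOL functions, so equality of functors with
  domain \<open>G\<close> is agreement on the objects and arrows of \<open>G\<close>.\<close>

definition functor_eq ::
  "('o, 'm) gpd \<Rightarrow> ('o, 'm, 'p, 'n) fctr \<Rightarrow> ('o, 'm, 'p, 'n) fctr \<Rightarrow> bool" where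
  "functor_eq G F F' \<longleftrightarrow>
     (\<forall>x\<in>Ob G. fobj F x = fobj F' x) \<and>
     (\<forall>x\<in>Ob G. \<forall>y\<in>Ob G. \<forall>f\<in>Hom G x y. farr F x y f = farr F' x y f)"

definition functor_id :: "('o, 'm, 'o, 'm) fctr" where
  "functor_id = \<lparr>fobj = (\<lambda>x. x), farr = (\<lambda>x y f. f)\<rparr>"

definition functor_comp ::
  "('p, 'n, 'q, 'k) fctr \<Rightarrow> ('o, 'm, 'p, 'n) fctr \<Rightarrow> ('o, 'm, 'q, 'k) fctr" (infixr \<open>\<circ>\<^sub>F\<close> 55) where
  "K \<circ>\<^sub>F F = \<lparr>fobj = (\<lambda>x. fobj K (fobj F x)),
     farr = (\<lambda>x y f. farr K (fobj F x) (fobj F y) (farr F x y f))\<rparr>"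

definition inverse_functors ::
  "('o, 'm) gpd \<Rightarrow> ('p, 'n) gpd \<Rightarrow> ('o, 'm, 'p, 'n) fctr \<Rightarrow> ('p, 'n, 'o, 'm) fctr \<Rightarrow> bool" where
  "inverse_functors G H F K \<longleftrightarrow>
     is_functor G H F \<and> is_functor H G K \<and>
     functor_eq G (K \<circ>\<^sub>F F) functor_id \<and> functor_eq H (F \<circ>\<^sub>F K) functor_id"

definition functor_iso :: "('o, 'm) gpd \<Rightarrow> ('p, 'n) gpd \<Rightarrow> ('o, 'm, 'p, 'n) fctr \<Rightarrow> bool" where
  "functor_iso G H F \<longleftrightarrow> (\<exists>K. inverse_functors G H F K)"

definition gpd_prod ::
  "('o, 'm) gpd \<Rightarrow> ('p, 'n) gpd \<Rightarrow> ('o \<times> 'p, 'm \<times> 'n) gpd" (infixr \<open>\<times>\<^sub>G\<close> 70) where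
  "G \<times>\<^sub>G H = \<lparr>Ob = Ob G \<times> Ob H,
     Hom = (\<lambda>(x, y) (x', y'). Hom G x x' \<times> Hom H y y'),
     Ident = (\<lambda>(x, y). (Ident G x, Ident H y)),
     Comp = (\<lambda>(x, y) (x', y') (x'', y'') (g, k) (f, h). (Comp G x x' x'' g f, Comp H y y' y'' k h)),
     Inv = (\<lambda>(x, y) (x', y') (f, h). (Inv G x x' f, Inv H y y' h))\<rparr>"

definition gpd_unit :: "(unit, unit) gpd" where
  "gpd_unit = \<lparr>Ob = {()}, Hom = (\<lambda>_ _. {()}), Ident = (\<lambda>_. ()),
     Comp = (\<lambda>_ _ _ _ _. ()), Inv = (\<lambda>_ _ _. ())\<rparr>"

definition functor_pair ::
  "('o, 'm, 'p, 'n) fctr \<Rightarrow> ('o, 'm, 'q, 'k) fctr \<Rightarrow> ('o, 'm, 'p \<times> 'q, 'n \<times> 'k) fctr" where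
  "functor_pair F K = \<lparr>fobj = (\<lambda>x. (fobj F x, fobj K x)),
     farr = (\<lambda>x y f. (farr F x y f, farr K x y f))\<rparr>"

definition functor_prod ::
  "('o, 'm, 'o2, 'm2) fctr \<Rightarrow> ('p, 'n, 'p2, 'n2) fctr \<Rightarrow>
   ('o \<times> 'p, 'm \<times> 'n, 'o2 \<times> 'p2, 'm2 \<times> 'n2) fctr" (infixr \<open>\<times>\<^sub>F\<close> 70) where
  "F \<times>\<^sub>F K = \<lparr>fobj = (\<lambda>(x, y). (fobj F x, fobj K y)),
     farr = (\<lambda>(x, y) (x', y') (f, h). (farr F x x' f, farr K y y' h))\<rparr>"

definition gpd_assoc ::
  "(('o \<times> 'p) \<times> 'q, ('m \<times> 'n) \<times> 'k, 'o \<times> ('p \<times> 'q), 'm \<times> ('n \<times> 'k)) fctr" where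
  "gpd_assoc = \<lparr>fobj = (\<lambda>((x, y), z). (x, (y, z))),
     farr = (\<lambda>_ _ ((f, g), h). (f, (g, h)))\<rparr>"

definition gpd_lunit :: "(unit \<times> 'o, unit \<times> 'm, 'o, 'm) fctr" where
  "gpd_lunit = \<lparr>fobj = snd, farr = (\<lambda>_ _. snd)\<rparr>"

definition gpd_runit :: "('o \<times> unit, 'm \<times> unit, 'o, 'm) fctr" where
  "gpd_runit = \<lparr>fobj = fst, farr = (\<lambda>_ _. fst)\<rparr>"


section \<open>The fundamental groupoid\<close>

text \<open>A morphism of the fundamental groupoid is a set of sets of paths: a path component of the
  quotient graph, whose vertices are themselves classes of paths. So the representatives of
  a morphism \<open>a\<close> are the elements of \<open>\<Union>a\<close>. Operations on morphisms are given on representatives;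
  the lemmas at the end show that they do not depend on the choice.\<close>

type_synonym 'a path_class = "'a path set set"

definition path_class :: "'a pregraph \<Rightarrow> 'a \<Rightarrow> 'a \<Rightarrow> 'a path \<Rightarrow> 'a path_class" where
  "path_class X x x' p = connected_rel (path_graph_N X x x') `` {shrink_equiv X x x' `` {p}}"

definition Pi1 :: "'a pregraph \<Rightarrow> ('a, 'a path_class) gpd" where
  "Pi1 X = \<lparr>Ob = verts X,
     Hom = (\<lambda>x x'. pi0 (path_graph_N X x x')),
     Ident = (\<lambda>x. path_class X x x (path_const x)),
     Comp = (\<lambda>x x' x'' b a.
        the_elem ((\<lambda>(\<gamma>, \<sigma>). path_class X x x'' (\<gamma> \<star> \<sigma>)) ` (\<Union>a \<times> \<Union>b))),
     Inv = (\<lambda>x x' a. the_elem ((\<lambda>\<gamma>. path_class X x' x (path_reverse \<gamma>)) ` \<Union>a))\<rparr>"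

definition Pi1_map ::
  "'b pregraph \<Rightarrow> ('a \<Rightarrow> 'b) \<Rightarrow> ('a, 'a path_class, 'b, 'b path_class) fctr" where
  "Pi1_map Y f = \<lparr>fobj = f,
     farr = (\<lambda>x x' a. the_elem ((\<lambda>\<gamma>. path_class Y (f x) (f x') (path_map f \<gamma>)) ` \<Union>a))\<rparr>"

definition Psi ::
  "'a pregraph \<Rightarrow> 'b pregraph \<Rightarrow>
   ('a \<times> 'b, ('a \<times> 'b) path_class, 'a \<times> 'b, 'a path_class \<times> 'b path_class) fctr" where
  "Psi X Y = functor_pair (Pi1_map X (box_fst X Y)) (Pi1_map Y (box_snd X Y))"

definition path_box_left :: "'a path \<Rightarrow> 'b \<Rightarrow> ('a \<times> 'b) path" where
  "path_box_left p y = (fst p, \<lambda>i\<in>verts (interval (fst p)). (snd p i, y))"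

definition path_box_right :: "'a \<Rightarrow> 'b path \<Rightarrow> ('a \<times> 'b) path" where
  "path_box_right x q = (fst q, \<lambda>j\<in>verts (interval (fst q)). (x, snd q j))"

definition Phi ::
  "'a pregraph \<Rightarrow> 'b pregraph \<Rightarrow>
   ('a \<times> 'b, 'a path_class \<times> 'b path_class, 'a \<times> 'b, ('a \<times> 'b) path_class) fctr" where
  "Phi X Y = \<lparr>fobj = (\<lambda>v. v),
     farr = (\<lambda>(x, y) (x', y') (a, b).
        the_elem ((\<lambda>(\<sigma>, \<tau>). path_class (X \<box> Y) (x, y) (x', y')
                      (path_box_left \<sigma> y \<star> path_box_right x' \<tau>)) ` (\<Union>a \<times> \<Union>b)))\<rparr>"

definition Pi1_unit :: "(unit, unit, nat, nat path_class) fctr" where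
  "Pi1_unit = \<lparr>fobj = (\<lambda>_. 0), farr = (\<lambda>_ _ _. Ident (Pi1 (interval 0)) 0)\<rparr>"


section \<open>Independence of representatives\<close>

lemma simple_graphD:
  assumes "simple_graph X" "adj X x y"
  shows "x \<in> verts X" "y \<in> verts X" "x \<noteq> y" "adj X y x"
  using assms unfolding simple_graph_def by blast+

lemma verts_interval [simp]: "verts (interval n) = {..n}"
  by (simp add: interval_def)

lemma simple_graph_interval: "simple_graph (interval n)"
  by (auto simp: simple_graph_def interval_def)

lemma simple_graph_box: "simple_graph X \<Longrightarrow> simple_graph Y \<Longrightarrow> simple_graph (X \<box> Y)"
  by (fastforce simp: simple_graph_def box_def)

lemma graph_map_interval_iff:
  assumes "simple_graph X"
  shows "graph_map (interval n) X g \<longleftrightarrow>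
     g \<in> extensional {..n} \<and> (\<forall>i\<le>n. g i \<in> verts X) \<and>
     (\<forall>i<n. g i = g (Suc i) \<or> adj X (g i) (g (Suc i)))" (is "?L \<longleftrightarrow> ?R")
proof
  assume ?L
  then show ?R by (auto simp: graph_map_def interval_def PiE_def)
next
  assume R: ?R
  have "g i = g j \<or> adj X (g i) (g j)" if "adj (interval n) i j" for i j
  proof -
    from that have "i \<le> n" "j \<le> n" "j = Suc i \<or> i = Suc j" by (auto simp: interval_def)
    then show ?thesis using R simple_graphD(4)[OF assms] by (metis Suc_le_lessD)
  qed
  then show ?L using R by (auto simp: graph_map_def PiE_def)
qed

lemma shrinking_iff:
  "shrinking m n s \<longleftrightarrow> s \<in> extensional {..m} \<and> s 0 = 0 \<and> s m = n \<and>
     (\<forall>i<m. s (Suc i) = s i \<or> s (Suc i) = Suc (s i))" (is "?L \<longleftrightarrow> ?R")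
proof
  assume L: ?L
  then have ext: "s \<in> extensional {..m}" and le: "\<forall>i\<le>m. s i \<le> n"
    and step: "\<forall>i<m. s i = s (Suc i) \<or> adj (interval n) (s i) (s (Suc i))"
    and img: "s ` {..m} = {..n}" and mono: "mono_on {..m} s"
    by (auto simp: shrinking_def graph_map_interval_iff simple_graph_interval)
  have m: "s i \<le> s j" if "i \<le> j" "j \<le> m" for i j
    using mono that by (auto simp: monotone_on_def)
  from img obtain i where "i \<le> m" "s i = 0" by (metis atMost_iff imageE zero_le)
  then have "s 0 = 0" using m[of 0 i] by simp
  moreover from img obtain j where "j \<le> m" "s j = n" by (metis atMost_iff imageE order_refl)
  then have "s m = n" using m[of j m] le by (simp add: le_antisym)
  moreover have "s (Suc i) = s i \<or> s (Suc i) = Suc (s i)" if "i < m" for i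
    using step that m[of i "Suc i"] by (auto simp: interval_def)
  ultimately show ?R using ext by blast
next
  assume R: ?R
  have m: "s i \<le> s j" if "i \<le> j" "j \<le> m" for i j
    using that
  proof (induction j rule: dec_induct)
    case (step k)
    then have "s i \<le> s k" "s (Suc k) = s k \<or> s (Suc k) = Suc (s k)"
      using R by auto
    then show ?case by auto
  qed simp
  have "\<exists>i\<le>m. s i = k" if "k \<le> s j" "j \<le> m" for k j
    using that
  proof (induction j)
    case 0 then show ?case using R by auto
  next
    case (Suc j)
    then have "s (Suc j) = s j \<or> s (Suc j) = Suc (s j)" using R by auto
    with Suc show ?case by (metis Suc_leD le_SucE)
  qed
  then have "{..n} \<subseteq> s ` {..m}" using R by fastforce
  moreover have "s i \<le> n" if "i \<le> m" for i using m[of i m] R that by simp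
  moreover have "s i = s (Suc i) \<or> adj (interval n) (s i) (s (Suc i))" if "i < m" for i
    using R that \<open>\<And>i. i \<le> m \<Longrightarrow> s i \<le> n\<close>[of i] \<open>\<And>i. i \<le> m \<Longrightarrow> s i \<le> n\<close>[of "Suc i"]
    by (auto simp: interval_def)
  ultimately show ?L
    using R m by (auto simp: shrinking_def graph_map_interval_iff simple_graph_interval
        monotone_on_def)
qed

lemma shrinking_le:
  assumes "shrinking m n s" "i \<le> m" shows "s i \<le> n"
  using assms by (auto simp: shrinking_def graph_map_def)

lemma paths_iff:
  assumes "simple_graph X"
  shows "p \<in> paths X x x' \<longleftrightarrow> snd p \<in> extensional {..fst p} \<and>
     (\<forall>i\<le>fst p. snd p i \<in> verts X) \<and>
     (\<forall>i<fst p. snd p i = snd p (Suc i) \<or> adj X (snd p i) (snd p (Suc i))) \<and>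
     snd p 0 = x \<and> snd p (fst p) = x'"
  by (cases p) (auto simp: coprod_path_graph_def path_graph_def Let_def graph_map_interval_iff[OF assms])

lemma adj_coprod_path_graph_iff:
  "adj (coprod_path_graph X x x') p q \<longleftrightarrow>
     p \<in> paths X x x' \<and> q \<in> paths X x x' \<and> p \<noteq> q \<and> fst p = fst q \<and>
     (\<forall>i\<le>fst p. snd p i = snd q i \<or> adj X (snd p i) (snd q i))"
  by (cases p; cases q) (auto simp: coprod_path_graph_def path_graph_def Let_def)

lemma shrink_step_paths:
  assumes "simple_graph X" "shrink_step X x x' p q"
  shows "q \<in> paths X x x'"
proof -
  obtain s where s: "shrinking (fst q) (fst p) s" "snd q = compose {..fst q} (snd p) s"
    and p: "p \<in> paths X x x'"
    using assms(2) by (auto simp: shrink_step_def graph_comp_def)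
  have "snd q i = snd q (Suc i) \<or> adj X (snd q i) (snd q (Suc i))" if "i < fst q" for i
  proof -
    have "s (Suc i) = s i \<or> s (Suc i) = Suc (s i)" using s(1) that by (auto simp: shrinking_iff)
    moreover have "s (Suc i) \<le> fst p" using shrinking_le[OF s(1)] that by simp
    ultimately show ?thesis using p that
      by (auto simp: paths_iff[OF assms(1)] s(2) compose_def Suc_le_eq)
  qed
  then show ?thesis using p s shrinking_le[OF s(1)]
    by (auto simp: paths_iff[OF assms(1)] compose_def shrinking_iff)
qed

lemma equiv_generated: "equiv A (generated_equiv A r)"
  by (rule equivI) (auto simp: generated_equiv_def refl_on_def sym_def trans_def
      intro: equivclp_sym equivclp_trans)

lemma equiv_shrink_equiv: "equiv (paths X x x') (shrink_equiv X x x')"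
  unfolding shrink_equiv_def by (rule equiv_generated)

lemma connected_rel_adj_closure:
  assumes "simple_graph X"
  shows "(a, b) \<in> connected_rel X \<longleftrightarrow> a \<in> verts X \<and> (adj X)\<^sup>*\<^sup>* a b"
proof
  assume "(a, b) \<in> connected_rel X"
  then obtain n g where g: "graph_map (interval n) X g" "g 0 = a" "g n = b"
    by (auto simp: connected_rel_def path_graph_def Let_def)
  have "(adj X)\<^sup>*\<^sup>* (g 0) (g k)" if "k \<le> n" for k
    using that
  proof (induction k)
    case (Suc k)
    then have "g k = g (Suc k) \<or> adj X (g k) (g (Suc k))"
      using g by (auto simp: graph_map_interval_iff[OF assms])
    then show ?case using Suc by (metis Suc_leD rtranclp.rtrancl_into_rtrancl)
  qed simp
  then show "a \<in> verts X \<and> (adj X)\<^sup>*\<^sup>* a b"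
    using g by (auto simp: graph_map_interval_iff[OF assms])
next
  assume R: "a \<in> verts X \<and> (adj X)\<^sup>*\<^sup>* a b"
  then have "(adj X)\<^sup>*\<^sup>* a b" by simp
  then have "\<exists>n g. graph_map (interval n) X g \<and> g 0 = a \<and> g n = b"
  proof (induction rule: rtranclp_induct)
    case base
    show ?case
      by (rule exI[of _ 0], rule exI[of _ "\<lambda>i\<in>{..0}. a"])
        (use R in \<open>auto simp: graph_map_interval_iff[OF assms] extensional_def\<close>)
  next
    case (step y z)
    then obtain n g where g: "graph_map (interval n) X g" "g 0 = a" "g n = y" by blast
    let ?h = "\<lambda>i\<in>{..Suc n}. if i \<le> n then g i else z"
    have "graph_map (interval (Suc n)) X ?h"
      using g step(2) simple_graphD(2)[OF assms step(2)]
      by (auto simp: graph_map_interval_iff[OF assms] less_Suc_eq)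
    moreover have "?h 0 = a" "?h (Suc n) = z" using g by auto
    ultimately show ?case by blast
  qed
  then show "(a, b) \<in> connected_rel X"
    by (auto simp: connected_rel_def path_graph_def Let_def)
qed

lemma equiv_connected_rel:
  assumes "simple_graph X"
  shows "equiv (verts X) (connected_rel X)"
proof (rule equivI)
  have v: "(adj X)\<^sup>*\<^sup>* a b \<Longrightarrow> a \<in> verts X \<Longrightarrow> b \<in> verts X" for a b
    by (induction rule: rtranclp_induct) (auto dest: simple_graphD(2)[OF assms])
  show "connected_rel X \<subseteq> verts X \<times> verts X"
    using v by (auto simp: connected_rel_adj_closure[OF assms])
  show "refl_on (verts X) (connected_rel X)"
    by (auto simp: refl_on_def connected_rel_adj_closure[OF assms])
  have "symp (adj X)" using simple_graphD(4)[OF assms] by (auto simp: symp_def)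
  then have "symp (adj X)\<^sup>*\<^sup>*" by (rule symp_rtranclp)
  then show "sym (connected_rel X)"
    using v by (auto simp: sym_def connected_rel_adj_closure[OF assms] dest: sympD)
  show "trans (connected_rel X)"
    by (auto simp: trans_def connected_rel_adj_closure[OF assms] intro: rtranclp_trans)
qed

lemma simple_graph_coprod:
  assumes "simple_graph X"
  shows "simple_graph (coprod_path_graph X x x')"
  unfolding simple_graph_def adj_coprod_path_graph_iff
  using simple_graphD(4)[OF assms] by metis

lemma simple_graph_path_graph_N:
  assumes "simple_graph X"
  shows "simple_graph (path_graph_N X x x')"
  using simple_graphD(4)[OF simple_graph_coprod[OF assms]]
  by (fastforce simp: simple_graph_def path_graph_N_def quotient_graph_def)

lemma path_class_eqI_shrink:
  assumes "simple_graph X" "shrink_step X x x' p q"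
  shows "path_class X x x' p = path_class X x x' q"
proof -
  have "(p, q) \<in> shrink_equiv X x x'"
    using assms shrink_step_paths[OF assms]
    by (auto simp: shrink_equiv_def generated_equiv_def r_into_equivclp)
      (auto simp: shrink_step_def)
  then show ?thesis
    unfolding path_class_def using equiv_class_eq[OF equiv_shrink_equiv] by metis
qed

lemma path_class_eqI_adj:
  assumes "simple_graph X" "adj (coprod_path_graph X x x') p q"
  shows "path_class X x x' p = path_class X x x' q"
proof -
  let ?E = "shrink_equiv X x x'" and ?N = "path_graph_N X x x'"
  have pq: "p \<in> paths X x x'" "q \<in> paths X x x'"
    using assms by (auto simp: adj_coprod_path_graph_iff)
  then have mem: "p \<in> ?E `` {p}" "q \<in> ?E `` {q}"
    using equiv_class_self[OF equiv_shrink_equiv] by metis+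
  have "?E `` {p} = ?E `` {q} \<or> adj ?N (?E `` {p}) (?E `` {q})"
    using pq mem assms(2) by (auto simp: path_graph_N_def quotient_graph_def quotientI)
  moreover have "?E `` {p} \<in> verts ?N"
    using pq by (auto simp: path_graph_N_def quotient_graph_def quotientI)
  ultimately have "(?E `` {p}, ?E `` {q}) \<in> connected_rel ?N"
    using connected_rel_adj_closure[OF simple_graph_path_graph_N[OF assms(1)]] by auto
  then show ?thesis unfolding path_class_def
    by (rule equiv_class_eq[OF equiv_connected_rel[OF simple_graph_path_graph_N[OF assms(1)]]])
qed

lemma path_class_lift:
  assumes X: "simple_graph X"
    and shr: "\<And>p q. shrink_step X x x' p q \<Longrightarrow> F p = F q"
    and adj: "\<And>p q. adj (coprod_path_graph X x x') p q \<Longrightarrow> F p = F q"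
    and p: "p \<in> paths X x x'" and q: "q \<in> paths X x x'"
    and eq: "path_class X x x' p = path_class X x x' q"
  shows "F p = F q"
proof -
  let ?E = "shrink_equiv X x x'" and ?N = "path_graph_N X x x'"
  have E: "F a = F b" if "(a, b) \<in> ?E" for a b
  proof -
    have "equivclp (shrink_step X x x') a b"
      using that by (auto simp: shrink_equiv_def generated_equiv_def)
    then show ?thesis
      by (induction rule: equivclp_induct) (auto dest: shr)
  qed
  have Q: "F a = F b" if "A \<in> paths X x x' // ?E" "a \<in> A" "b \<in> A" for A a b
    by (rule E, rule in_quotient_imp_in_rel[OF equiv_shrink_equiv that(1)]) (use that in simp)
  have conn: "\<forall>a\<in>A. \<forall>b\<in>B. F a = F b" if "(adj ?N)\<^sup>*\<^sup>* A B" "A \<in> verts ?N" for A B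
    using that(1)
  proof (induction rule: rtranclp_induct)
    case base
    have "A \<in> paths X x x' // ?E"
      using that(2) by (simp add: path_graph_N_def quotient_graph_def)
    then show ?case by (intro ballI) (rule Q)
  next
    case (step B C)
    from step(2) obtain b c where b: "b \<in> B" and c: "c \<in> C"
      and bc: "adj (coprod_path_graph X x x') b c" and C: "C \<in> paths X x x' // ?E"
      by (auto simp: path_graph_N_def quotient_graph_def)
    show ?case
    proof (intro ballI)
      fix a c' assume a: "a \<in> A" and c': "c' \<in> C"
      have "F a = F b" using step(3) a b by blast
      also have "F b = F c" by (rule adj[OF bc])
      also have "F c = F c'" by (rule Q[OF C c c'])
      finally show "F a = F c'" .
    qed
  qed
  have vp: "?E `` {p} \<in> verts ?N" and vq: "?E `` {q} \<in> verts ?N"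
    using p q by (simp_all add: path_graph_N_def quotient_graph_def quotientI)
  have "(?E `` {p}, ?E `` {q}) \<in> connected_rel ?N"
    using eq unfolding path_class_def
    by (rule eq_equiv_class[OF _ equiv_connected_rel[OF simple_graph_path_graph_N[OF X]] vq])
  then have pq: "(adj ?N)\<^sup>*\<^sup>* (?E `` {p}) (?E `` {q})"
    using connected_rel_adj_closure[OF simple_graph_path_graph_N[OF X]] by blast
  have "p \<in> ?E `` {p}" "q \<in> ?E `` {q}"
    by (rule equiv_class_self[OF equiv_shrink_equiv p])
      (rule equiv_class_self[OF equiv_shrink_equiv q])
  then show ?thesis using conn[OF pq vp] by blast
qed

lemma Hom_Pi1:
  "Hom (Pi1 X) x x' = path_class X x x' ` paths X x x'"
proof -
  have "verts (path_graph_N X x x') = (\<lambda>p. shrink_equiv X x x' `` {p}) ` paths X x x'"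
    by (simp add: path_graph_N_def quotient_graph_def quotient_def UNION_singleton_eq_range)
  then show ?thesis
    by (simp add: Pi1_def pi0_def quotient_def UNION_singleton_eq_range image_image path_class_def)
qed

lemma Union_path_class:
  assumes "simple_graph X" "p \<in> paths X x x'"
  shows "\<Union> (path_class X x x' p) = {q \<in> paths X x x'. path_class X x x' q = path_class X x x' p}"
proof -
  let ?E = "shrink_equiv X x x'" and ?N = "path_graph_N X x x'"
  note eN = equiv_connected_rel[OF simple_graph_path_graph_N[OF assms(1)], of x x']
  have vN: "verts ?N = paths X x x' // ?E" by (simp add: path_graph_N_def quotient_graph_def)
  show ?thesis
  proof (intro set_eqI iffI)
    fix q assume "q \<in> \<Union> (path_class X x x' p)"
    then obtain A where A: "q \<in> A" "(?E `` {p}, A) \<in> connected_rel ?N"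
      by (auto simp: path_class_def)
    have "connected_rel ?N \<subseteq> verts ?N \<times> verts ?N" using eN unfolding equiv_def by (rule conjunct1)
    with A(2) have "A \<in> paths X x x' // ?E" unfolding vN by blast
    then obtain r where "r \<in> paths X x x'" and r: "A = ?E `` {r}" by (rule quotientE)
    then have rq: "(r, q) \<in> ?E" using A(1) by simp
    then have q: "q \<in> paths X x x'" by (simp add: shrink_equiv_def generated_equiv_def)
    have "A = ?E `` {q}" using r equiv_class_eq[OF equiv_shrink_equiv rq] by simp
    with q show "q \<in> {q \<in> paths X x x'. path_class X x x' q = path_class X x x' p}"
      using equiv_class_eq[OF eN A(2)] by (simp add: path_class_def)
  next
    fix q assume "q \<in> {q \<in> paths X x x'. path_class X x x' q = path_class X x x' p}"
    then have q: "q \<in> paths X x x'" "path_class X x x' q = path_class X x x' p" by auto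
    then have "?E `` {q} \<in> verts ?N" by (simp add: vN quotientI)
    then have "?E `` {q} \<in> path_class X x x' q"
      unfolding path_class_def by (rule equiv_class_self[OF eN])
    then have "?E `` {q} \<in> path_class X x x' p" using q(2) by simp
    then show "q \<in> \<Union> (path_class X x x' p)"
      using equiv_class_self[OF equiv_shrink_equiv q(1)] by blast
  qed
qed

lemma the_elem_image_const:
  assumes "a \<in> A" "\<And>b. b \<in> A \<Longrightarrow> h b = h a"
  shows "the_elem (h ` A) = h a"
proof -
  have "h ` A \<subseteq> {h a}"
  proof (rule image_subsetI)
    fix b assume "b \<in> A"
    then have "h b = h a" by (rule assms(2))
    then show "h b \<in> {h a}" by simp
  qed
  moreover have "{h a} \<subseteq> h ` A" using assms(1) by blast
  ultimately have "h ` A = {h a}" by (rule subset_antisym)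
  then show ?thesis by simp
qed

lemma path_concat_in_paths:
  assumes X: "simple_graph X" and p: "p \<in> paths X x y" and q: "q \<in> paths X y z"
  shows "p \<star> q \<in> paths X x z"
proof -
  have pv: "\<And>i. i \<le> fst p \<Longrightarrow> snd p i \<in> verts X"
    and ps: "\<And>i. i < fst p \<Longrightarrow> snd p i = snd p (Suc i) \<or> adj X (snd p i) (snd p (Suc i))"
    and p0: "snd p 0 = x" and p1: "snd p (fst p) = y"
    using p unfolding paths_iff[OF X] by blast+
  have qv: "\<And>i. i \<le> fst q \<Longrightarrow> snd q i \<in> verts X"
    and qs: "\<And>i. i < fst q \<Longrightarrow> snd q i = snd q (Suc i) \<or> adj X (snd q i) (snd q (Suc i))"
    and q0: "snd q 0 = y" and q1: "snd q (fst q) = z"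
    using q unfolding paths_iff[OF X] by blast+
  have len: "fst (p \<star> q) = fst p + fst q" by (simp add: path_concat_def)
  have l: "snd (p \<star> q) i = snd p i" if "i \<le> fst p" for i
    using that by (simp add: path_concat_def)
  have r: "snd (p \<star> q) (fst p + k) = snd q k" if "k \<le> fst q" for k
    using that p1 q0 by (simp add: path_concat_def)
  have "snd (p \<star> q) i = snd (p \<star> q) (Suc i) \<or> adj X (snd (p \<star> q) i) (snd (p \<star> q) (Suc i))"
    if "i < fst p + fst q" for i
  proof (cases "i < fst p")
    case True
    then show ?thesis using ps[OF True] l[of i] l[of "Suc i"] by simp
  next
    case False
    then obtain k where k: "i = fst p + k" by (metis le_Suc_ex not_less)
    then have "k < fst q" using that by simp
    then show ?thesis using qs[of k] r[of k] r[of "Suc k"] k by simp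
  qed
  moreover have "snd (p \<star> q) i \<in> verts X" if "i \<le> fst p + fst q" for i
    using that pv qv by (simp add: path_concat_def)
  moreover have "snd (p \<star> q) (fst p + fst q) = z" using r[of "fst q"] q1 by simp
  moreover have "snd (p \<star> q) 0 = x" using l[of 0] p0 by simp
  moreover have "snd (p \<star> q) \<in> extensional {..fst p + fst q}" by (simp add: path_concat_def)
  ultimately show ?thesis unfolding paths_iff[OF X] len by blast
qed

lemma path_class_eqI_close:
  assumes X: "simple_graph X" and p: "p \<in> paths X x y" and q: "q \<in> paths X x y"
    and len: "fst p = fst q"
    and close: "\<And>i. i \<le> fst p \<Longrightarrow> snd p i = snd q i \<or> adj X (snd p i) (snd q i)"
  shows "path_class X x y p = path_class X x y q"
proof (cases "p = q")
  case False
  then have "adj (coprod_path_graph X x y) p q"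
    unfolding adj_coprod_path_graph_iff using p q len close by blast
  then show ?thesis by (rule path_class_eqI_adj[OF X])
qed simp

lemma path_class_eqI_reparam:
  assumes X: "simple_graph X" and p: "p \<in> paths X x y" and q: "q \<in> paths X x y"
    and s: "shrinking (fst q) (fst p) s"
    and eq: "\<And>i. i \<le> fst q \<Longrightarrow> snd q i = snd p (s i)"
  shows "path_class X x y p = path_class X x y q"
proof -
  have "snd q \<in> extensional {..fst q}" using q unfolding paths_iff[OF X] by blast
  then have "snd q = graph_comp (interval (fst q)) (snd p) s"
    unfolding graph_comp_def verts_interval
    by (rule extensionalityI[where A = "{..fst q}"]) (simp_all add: eq compose_def)
  then have "shrink_step X x y p q" using p s unfolding shrink_step_def by blast
  then show ?thesis by (rule path_class_eqI_shrink[OF X])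
qed

lemma shrink_stepE:
  assumes "simple_graph X" "shrink_step X x y p q"
  obtains s where "p \<in> paths X x y" "q \<in> paths X x y" "shrinking (fst q) (fst p) s"
    "\<And>i. i \<le> fst q \<Longrightarrow> snd q i = snd p (s i)" "\<And>i. i \<le> fst q \<Longrightarrow> s i \<le> fst p"
proof -
  obtain s where s: "shrinking (fst q) (fst p) s" "snd q = compose {..fst q} (snd p) s"
    and p: "p \<in> paths X x y"
    using assms(2) unfolding shrink_step_def graph_comp_def verts_interval by blast
  have "\<And>i. i \<le> fst q \<Longrightarrow> snd q i = snd p (s i)" unfolding s(2) by (simp add: compose_def)
  then show thesis using that[OF p shrink_step_paths[OF assms] s(1)] shrinking_le[OF s(1)] by blast
qed

lemma path_endpoint_eqs:
  assumes "simple_graph X" "p \<in> paths X x y"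
  shows "snd p 0 = x" "snd p (fst p) = y"
  using assms unfolding paths_iff[OF assms(1)] by blast+

lemma fst_path_concat: "fst (p \<star> q) = fst p + fst q"
  by (simp add: path_concat_def)

lemma path_concat_left: "i \<le> fst p \<Longrightarrow> snd (p \<star> q) i = snd p i"
  by (simp add: path_concat_def)

lemma path_concat_right:
  assumes "simple_graph X" "p \<in> paths X x y" "q \<in> paths X y z" "k \<le> fst q"
  shows "snd (p \<star> q) (fst p + k) = snd q k"
  using assms(4) path_endpoint_eqs[OF assms(1,2)] path_endpoint_eqs[OF assms(1,3)]
  by (simp add: path_concat_def)

lemma le_add_cases:
  fixes i m n :: nat
  assumes "i \<le> m + n"
  obtains "i \<le> m" | k where "i = m + k" "0 < k" "k \<le> n"
  by (cases "i \<le> m") (use assms in \<open>auto simp: not_le dest!: less_imp_Suc_add\<close>)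

lemma path_class_concat_cong:
  assumes X: "simple_graph X"
    and p: "p \<in> paths X x y" "p' \<in> paths X x y" "path_class X x y p = path_class X x y p'"
    and q: "q \<in> paths X y z" "q' \<in> paths X y z" "path_class X y z q = path_class X y z q'"
  shows "path_class X x z (p \<star> q) = path_class X x z (p' \<star> q')"
proof -
  have "path_class X x z (p \<star> q) = path_class X x z (p' \<star> q)"
  proof (rule path_class_lift[OF X _ _ p, where F = "\<lambda>p. path_class X x z (p \<star> q)"])
    fix a b assume "shrink_step X x y a b"
    then obtain s where a: "a \<in> paths X x y" and b: "b \<in> paths X x y"
      and s: "shrinking (fst b) (fst a) s"
      and sb: "\<And>i. i \<le> fst b \<Longrightarrow> snd b i = snd a (s i)"
      and sl: "\<And>i. i \<le> fst b \<Longrightarrow> s i \<le> fst a"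
      by (rule shrink_stepE[OF X]) blast
    define t where "t = (\<lambda>i\<in>{..fst b + fst q}. if i \<le> fst b then s i else fst a + (i - fst b))"
    have t1: "t i = s i" if "i \<le> fst b" for i using that by (simp add: t_def)
    have sm: "s (fst b) = fst a" using s unfolding shrinking_iff by blast
    have t2: "t (fst b + k) = fst a + k" if "k \<le> fst q" for k
      using that sm by (simp add: t_def)
    have "t (Suc i) = t i \<or> t (Suc i) = Suc (t i)" if "i < fst b + fst q" for i
    proof (cases "i < fst b")
      case True
      then have "s (Suc i) = s i \<or> s (Suc i) = Suc (s i)" using s unfolding shrinking_iff by blast
      then show ?thesis using True t1[of i] t1[of "Suc i"] by simp
    next
      case False
      then obtain k where "i = fst b + k" by (metis le_Suc_ex not_less)
      then show ?thesis using t2[of k] t2[of "Suc k"] that by simp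
    qed
    moreover have "t \<in> extensional {..fst b + fst q}" by (simp add: t_def)
    moreover have "t 0 = 0" using t1[of 0] s unfolding shrinking_iff by simp
    ultimately have t: "shrinking (fst (b \<star> q)) (fst (a \<star> q)) t"
      unfolding shrinking_iff fst_path_concat using t2[of "fst q"] by blast
    show "path_class X x z (a \<star> q) = path_class X x z (b \<star> q)"
    proof (rule path_class_eqI_reparam[OF X path_concat_in_paths[OF X a q(1)]
          path_concat_in_paths[OF X b q(1)] t])
      fix i assume "i \<le> fst (b \<star> q)"
      then have "i \<le> fst b + fst q" by (simp only: fst_path_concat)
      then show "snd (b \<star> q) i = snd (a \<star> q) (t i)"
      proof (cases rule: le_add_cases)
        case 1
        then show ?thesis using t1[of i] sl[of i] sb[of i] by (simp add: path_concat_left)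
      next
        case (2 k)
        then show ?thesis
          using t2[of k] path_concat_right[OF X a q(1), of k] path_concat_right[OF X b q(1), of k]
          by simp
      qed
    qed
  next
    fix a b assume "adj (coprod_path_graph X x y) a b"
    then have a: "a \<in> paths X x y" and b: "b \<in> paths X x y" and len: "fst a = fst b"
      and cl: "\<And>i. i \<le> fst a \<Longrightarrow> snd a i = snd b i \<or> adj X (snd a i) (snd b i)"
      unfolding adj_coprod_path_graph_iff by blast+
    show "path_class X x z (a \<star> q) = path_class X x z (b \<star> q)"
    proof (rule path_class_eqI_close[OF X path_concat_in_paths[OF X a q(1)]
          path_concat_in_paths[OF X b q(1)]])
      show "fst (a \<star> q) = fst (b \<star> q)" by (simp add: fst_path_concat len)
      fix i assume "i \<le> fst (a \<star> q)"
      then have "i \<le> fst a + fst q" by (simp only: fst_path_concat)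
      then show "snd (a \<star> q) i = snd (b \<star> q) i \<or> adj X (snd (a \<star> q) i) (snd (b \<star> q) i)"
      proof (cases rule: le_add_cases)
        case 1
        then show ?thesis using cl[of i] len by (simp add: path_concat_left)
      next
        case (2 k)
        then show ?thesis using len
            path_concat_right[OF X a q(1), of k] path_concat_right[OF X b q(1), of k] by simp
      qed
    qed
  qed
  also have "\<dots> = path_class X x z (p' \<star> q')"
  proof (rule path_class_lift[OF X _ _ q, where F = "\<lambda>q. path_class X x z (p' \<star> q)"])
    fix a b assume "shrink_step X y z a b"
    then obtain s where a: "a \<in> paths X y z" and b: "b \<in> paths X y z"
      and s: "shrinking (fst b) (fst a) s"
      and sb: "\<And>i. i \<le> fst b \<Longrightarrow> snd b i = snd a (s i)"
      and sl: "\<And>i. i \<le> fst b \<Longrightarrow> s i \<le> fst a"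
      by (rule shrink_stepE[OF X]) blast
    define t where "t = (\<lambda>i\<in>{..fst p' + fst b}. if i \<le> fst p' then i else fst p' + s (i - fst p'))"
    have t1: "t i = i" if "i \<le> fst p'" for i using that by (simp add: t_def)
    have s0: "s 0 = 0" and sm: "s (fst b) = fst a" using s unfolding shrinking_iff by blast+
    have t2: "t (fst p' + k) = fst p' + s k" if "k \<le> fst b" for k
      using that s0 by (simp add: t_def)
    have "t (Suc i) = t i \<or> t (Suc i) = Suc (t i)" if "i < fst p' + fst b" for i
    proof (cases "i < fst p'")
      case True
      then show ?thesis using t1[of i] t1[of "Suc i"] by simp
    next
      case False
      then obtain k where k: "i = fst p' + k" by (metis le_Suc_ex not_less)
      then have "k < fst b" using that by simp
      then have "s (Suc k) = s k \<or> s (Suc k) = Suc (s k)" using s unfolding shrinking_iff by blast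
      then show ?thesis using t2[of k] t2[of "Suc k"] \<open>k < fst b\<close> k by auto
    qed
    moreover have "t \<in> extensional {..fst p' + fst b}" by (simp add: t_def)
    moreover have "t 0 = 0" using t1[of 0] by simp
    moreover have "t (fst p' + fst b) = fst p' + fst a" using t2[of "fst b"] sm by simp
    ultimately have t: "shrinking (fst (p' \<star> b)) (fst (p' \<star> a)) t"
      unfolding shrinking_iff fst_path_concat by blast
    show "path_class X x z (p' \<star> a) = path_class X x z (p' \<star> b)"
    proof (rule path_class_eqI_reparam[OF X path_concat_in_paths[OF X p(2) a]
          path_concat_in_paths[OF X p(2) b] t])
      fix i assume "i \<le> fst (p' \<star> b)"
      then have "i \<le> fst p' + fst b" by (simp only: fst_path_concat)
      then show "snd (p' \<star> b) i = snd (p' \<star> a) (t i)"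
      proof (cases rule: le_add_cases)
        case 1
        then show ?thesis using t1[of i] by (simp add: path_concat_left)
      next
        case (2 k)
        then show ?thesis using t2[of k] sl[of k] sb[of k]
            path_concat_right[OF X p(2) a, of "s k"] path_concat_right[OF X p(2) b, of k]
          by simp
      qed
    qed
  next
    fix a b assume "adj (coprod_path_graph X y z) a b"
    then have a: "a \<in> paths X y z" and b: "b \<in> paths X y z" and len: "fst a = fst b"
      and cl: "\<And>i. i \<le> fst a \<Longrightarrow> snd a i = snd b i \<or> adj X (snd a i) (snd b i)"
      unfolding adj_coprod_path_graph_iff by blast+
    show "path_class X x z (p' \<star> a) = path_class X x z (p' \<star> b)"
    proof (rule path_class_eqI_close[OF X path_concat_in_paths[OF X p(2) a]
          path_concat_in_paths[OF X p(2) b]])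
      show "fst (p' \<star> a) = fst (p' \<star> b)" by (simp add: fst_path_concat len)
      fix i assume "i \<le> fst (p' \<star> a)"
      then have "i \<le> fst p' + fst a" by (simp only: fst_path_concat)
      then show "snd (p' \<star> a) i = snd (p' \<star> b) i \<or> adj X (snd (p' \<star> a) i) (snd (p' \<star> b) i)"
      proof (cases rule: le_add_cases)
        case 1
        then show ?thesis by (simp add: path_concat_left)
      next
        case (2 k)
        then show ?thesis using cl[of k] len
            path_concat_right[OF X p(2) a, of k] path_concat_right[OF X p(2) b, of k] by simp
      qed
    qed
  qed
  finally show ?thesis .
qed

lemma path_reverse_in_paths:
  assumes X: "simple_graph X" and p: "p \<in> paths X x y"
  shows "path_reverse p \<in> paths X y x"
proof -
  have pv: "\<And>i. i \<le> fst p \<Longrightarrow> snd p i \<in> verts X"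
    and ps: "\<And>i. i < fst p \<Longrightarrow> snd p i = snd p (Suc i) \<or> adj X (snd p i) (snd p (Suc i))"
    and p0: "snd p 0 = x" and p1: "snd p (fst p) = y"
    using p unfolding paths_iff[OF X] by blast+
  have len: "fst (path_reverse p) = fst p" by (simp add: path_reverse_def)
  have r: "snd (path_reverse p) i = snd p (fst p - i)" if "i \<le> fst p" for i
    using that by (simp add: path_reverse_def)
  have "snd (path_reverse p) i = snd (path_reverse p) (Suc i) \<or>
      adj X (snd (path_reverse p) i) (snd (path_reverse p) (Suc i))"
    if "i < fst p" for i
  proof -
    define k where "k = fst p - Suc i"
    have k: "fst p - i = Suc k" "k < fst p" using that by (auto simp: k_def)
    have "snd p (Suc k) = snd p k \<or> adj X (snd p (Suc k)) (snd p k)"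
      using ps[OF k(2)] simple_graphD(4)[OF X] by metis
    moreover have "snd (path_reverse p) i = snd p (Suc k)" "snd (path_reverse p) (Suc i) = snd p k"
      using that r[of i] r[of "Suc i"] k(1) by (simp_all add: k_def)
    ultimately show ?thesis by simp
  qed
  moreover have "snd (path_reverse p) i \<in> verts X" if "i \<le> fst p" for i
    using r[OF that] pv[of "fst p - i"] by simp
  moreover have "snd (path_reverse p) 0 = y" "snd (path_reverse p) (fst p) = x"
    using r[of 0] r[of "fst p"] p0 p1 by simp_all
  moreover have "snd (path_reverse p) \<in> extensional {..fst p}" by (simp add: path_reverse_def)
  ultimately show ?thesis unfolding paths_iff[OF X] len by blast
qed

lemma path_class_reverse_cong:
  assumes X: "simple_graph X"
    and p: "p \<in> paths X x y" "p' \<in> paths X x y" "path_class X x y p = path_class X x y p'"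
  shows "path_class X y x (path_reverse p) = path_class X y x (path_reverse p')"
proof (rule path_class_lift[OF X _ _ p, where F = "\<lambda>p. path_class X y x (path_reverse p)"])
  have len: "fst (path_reverse r) = fst r" for r :: "'a path" by (simp add: path_reverse_def)
  have rev: "snd (path_reverse r) i = snd r (fst r - i)" if "i \<le> fst r" for r :: "'a path" and i
    using that by (simp add: path_reverse_def)
  {
    fix a b assume "shrink_step X x y a b"
    then obtain s where a: "a \<in> paths X x y" and b: "b \<in> paths X x y"
      and s: "shrinking (fst b) (fst a) s"
      and sb: "\<And>i. i \<le> fst b \<Longrightarrow> snd b i = snd a (s i)"
      and sl: "\<And>i. i \<le> fst b \<Longrightarrow> s i \<le> fst a"
      by (rule shrink_stepE[OF X]) blast
    define t where "t = (\<lambda>i\<in>{..fst b}. fst a - s (fst b - i))"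
    have t: "t i = fst a - s (fst b - i)" if "i \<le> fst b" for i using that by (simp add: t_def)
    have s0: "s 0 = 0" and sm: "s (fst b) = fst a" using s unfolding shrinking_iff by blast+
    have "t (Suc i) = t i \<or> t (Suc i) = Suc (t i)" if "i < fst b" for i
    proof -
      define k where "k = fst b - Suc i"
      have k: "fst b - i = Suc k" "k < fst b" using that by (auto simp: k_def)
      have "s (Suc k) = s k \<or> s (Suc k) = Suc (s k)" using s k(2) unfolding shrinking_iff by blast
      moreover have "t i = fst a - s (Suc k)" "t (Suc i) = fst a - s k"
        using t[of i] t[of "Suc i"] that k(1) by (simp_all add: k_def)
      ultimately show ?thesis using sl[of "Suc k"] k(2) by auto
    qed
    moreover have "t \<in> extensional {..fst b}" by (simp add: t_def)
    moreover have "t 0 = 0" "t (fst b) = fst a" using t[of 0] t[of "fst b"] s0 sm by simp_all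
    ultimately have sh: "shrinking (fst (path_reverse b)) (fst (path_reverse a)) t"
      unfolding shrinking_iff len by blast
    show "path_class X y x (path_reverse a) = path_class X y x (path_reverse b)"
    proof (rule path_class_eqI_reparam[OF X path_reverse_in_paths[OF X a]
          path_reverse_in_paths[OF X b] sh])
      fix i assume "i \<le> fst (path_reverse b)"
      then have i: "i \<le> fst b" by (simp only: len)
      then have "snd (path_reverse b) i = snd a (s (fst b - i))"
        using rev[of i b] sb[of "fst b - i"] by simp
      moreover have "snd (path_reverse a) (t i) = snd a (s (fst b - i))"
        using rev[of "t i" a] t[OF i] sl[of "fst b - i"] by simp
      ultimately show "snd (path_reverse b) i = snd (path_reverse a) (t i)" by simp
    qed
  next
    fix a b assume "adj (coprod_path_graph X x y) a b"
    then have a: "a \<in> paths X x y" and b: "b \<in> paths X x y" and ab: "fst a = fst b"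
      and cl: "\<And>i. i \<le> fst a \<Longrightarrow> snd a i = snd b i \<or> adj X (snd a i) (snd b i)"
      unfolding adj_coprod_path_graph_iff by blast+
    show "path_class X y x (path_reverse a) = path_class X y x (path_reverse b)"
    proof (rule path_class_eqI_close[OF X path_reverse_in_paths[OF X a]
          path_reverse_in_paths[OF X b]])
      show "fst (path_reverse a) = fst (path_reverse b)" by (simp add: len ab)
      fix i assume "i \<le> fst (path_reverse a)"
      then have i: "i \<le> fst a" by (simp only: len)
      then show "snd (path_reverse a) i = snd (path_reverse b) i \<or>
          adj X (snd (path_reverse a) i) (snd (path_reverse b) i)"
        using rev[of i a] rev[of i b] cl[of "fst a - i"] ab by simp
    qed
  }
qed

lemma path_map_in_paths:
  assumes "simple_graph X" "simple_graph Y" "graph_map X Y f" "p \<in> paths X x y"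
  shows "path_map f p \<in> paths Y (f x) (f y)"
proof -
  have "f (snd p i) = f (snd p (Suc i)) \<or> adj Y (f (snd p i)) (f (snd p (Suc i)))"
    if "i < fst p" for i
    using assms that unfolding paths_iff[OF assms(1)] graph_map_def by metis
  then show ?thesis
    using assms by (auto simp: paths_iff path_map_def graph_comp_def compose_def graph_map_def)
qed

lemma path_class_map_cong:
  assumes X: "simple_graph X" and Y: "simple_graph Y" and f: "graph_map X Y f"
    and p: "p \<in> paths X x y" "p' \<in> paths X x y" "path_class X x y p = path_class X x y p'"
  shows "path_class Y (f x) (f y) (path_map f p) = path_class Y (f x) (f y) (path_map f p')"
proof (rule path_class_lift[OF X _ _ p, where F = "\<lambda>p. path_class Y (f x) (f y) (path_map f p)"])
  have len: "fst (path_map f r) = fst r" for r by (simp add: path_map_def)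
  have pm: "snd (path_map f r) i = f (snd r i)" if "i \<le> fst r" for r i
    using that by (simp add: path_map_def graph_comp_def compose_def)
  {
    fix a b assume "shrink_step X x y a b"
    then obtain s where a: "a \<in> paths X x y" and b: "b \<in> paths X x y"
      and s: "shrinking (fst b) (fst a) s"
      and sb: "\<And>i. i \<le> fst b \<Longrightarrow> snd b i = snd a (s i)"
      and sl: "\<And>i. i \<le> fst b \<Longrightarrow> s i \<le> fst a"
      by (rule shrink_stepE[OF X]) blast
    have sh: "shrinking (fst (path_map f b)) (fst (path_map f a)) s" using s by (simp only: len)
    show "path_class Y (f x) (f y) (path_map f a) = path_class Y (f x) (f y) (path_map f b)"
    proof (rule path_class_eqI_reparam[OF Y path_map_in_paths[OF X Y f a]
          path_map_in_paths[OF X Y f b] sh])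
      fix i assume "i \<le> fst (path_map f b)"
      then have i: "i \<le> fst b" by (simp only: len)
      then show "snd (path_map f b) i = snd (path_map f a) (s i)"
        using pm[OF i] pm[OF sl[OF i]] sb[OF i] by simp
    qed
  next
    fix a b assume "adj (coprod_path_graph X x y) a b"
    then have a: "a \<in> paths X x y" and b: "b \<in> paths X x y" and ab: "fst a = fst b"
      and cl: "\<And>i. i \<le> fst a \<Longrightarrow> snd a i = snd b i \<or> adj X (snd a i) (snd b i)"
      unfolding adj_coprod_path_graph_iff by blast+
    show "path_class Y (f x) (f y) (path_map f a) = path_class Y (f x) (f y) (path_map f b)"
    proof (rule path_class_eqI_close[OF Y path_map_in_paths[OF X Y f a]
          path_map_in_paths[OF X Y f b]])
      show "fst (path_map f a) = fst (path_map f b)" by (simp add: len ab)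
      fix i assume "i \<le> fst (path_map f a)"
      then have i: "i \<le> fst a" by (simp only: len)
      then have "f (snd a i) = f (snd b i) \<or> adj Y (f (snd a i)) (f (snd b i))"
        using cl[OF i] f unfolding graph_map_def by metis
      then show "snd (path_map f a) i = snd (path_map f b) i \<or>
          adj Y (snd (path_map f a) i) (snd (path_map f b) i)"
        using pm[of i a] pm[of i b] i ab by simp
    qed
  }
qed

lemma Comp_Pi1:
  assumes X: "simple_graph X" and p: "p \<in> paths X x y" and q: "q \<in> paths X y z"
  shows "Comp (Pi1 X) x y z (path_class X y z q) (path_class X x y p) = path_class X x z (p \<star> q)"
proof -
  have "the_elem ((\<lambda>(p, q). path_class X x z (p \<star> q)) `
          (\<Union>(path_class X x y p) \<times> \<Union>(path_class X y z q))) =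
        (\<lambda>(p, q). path_class X x z (p \<star> q)) (p, q)"
  proof (rule the_elem_image_const)
    show "(p, q) \<in> \<Union>(path_class X x y p) \<times> \<Union>(path_class X y z q)"
      unfolding Union_path_class[OF X p] Union_path_class[OF X q] using p q by simp
    fix b assume b: "b \<in> \<Union>(path_class X x y p) \<times> \<Union>(path_class X y z q)"
    obtain c d where cd: "b = (c, d)" by (cases b)
    show "(\<lambda>(p, q). path_class X x z (p \<star> q)) b = (\<lambda>(p, q). path_class X x z (p \<star> q)) (p, q)"
      using b unfolding cd Union_path_class[OF X p] Union_path_class[OF X q] split_conv
      by (intro path_class_concat_cong[OF X _ p _ _ q]) simp_all
  qed
  then show ?thesis by (simp add: Pi1_def)
qed

lemma Inv_Pi1:
  assumes X: "simple_graph X" and p: "p \<in> paths X x y"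
  shows "Inv (Pi1 X) x y (path_class X x y p) = path_class X y x (path_reverse p)"
proof -
  have "the_elem ((\<lambda>p. path_class X y x (path_reverse p)) ` \<Union>(path_class X x y p)) =
        path_class X y x (path_reverse p)"
  proof (rule the_elem_image_const)
    show "p \<in> \<Union>(path_class X x y p)" unfolding Union_path_class[OF X p] using p by simp
    fix b assume "b \<in> \<Union>(path_class X x y p)"
    then show "path_class X y x (path_reverse b) = path_class X y x (path_reverse p)"
      unfolding Union_path_class[OF X p] by (intro path_class_reverse_cong[OF X _ p]) simp_all
  qed
  then show ?thesis by (simp add: Pi1_def)
qed

lemma farr_Pi1_map:
  assumes X: "simple_graph X" and Y: "simple_graph Y" and f: "graph_map X Y f"
    and p: "p \<in> paths X x y"
  shows "farr (Pi1_map Y f) x y (path_class X x y p) = path_class Y (f x) (f y) (path_map f p)"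
proof -
  have "the_elem ((\<lambda>p. path_class Y (f x) (f y) (path_map f p)) ` \<Union>(path_class X x y p)) =
        path_class Y (f x) (f y) (path_map f p)"
  proof (rule the_elem_image_const)
    show "p \<in> \<Union>(path_class X x y p)" unfolding Union_path_class[OF X p] using p by simp
    fix b assume "b \<in> \<Union>(path_class X x y p)"
    then show "path_class Y (f x) (f y) (path_map f b) = path_class Y (f x) (f y) (path_map f p)"
      unfolding Union_path_class[OF X p] by (intro path_class_map_cong[OF X Y f _ p]) simp_all
  qed
  then show ?thesis by (simp add: Pi1_map_def)
qed

lemma path_box_left_eq_map:
  assumes "simple_graph X" "p \<in> paths X x x'"
  shows "path_box_left p y = path_map (\<lambda>u\<in>verts X. (u, y)) p"
  using assms by (auto simp: path_box_left_def path_map_def graph_comp_def compose_def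
      paths_iff fun_eq_iff)

lemma path_box_right_eq_map:
  assumes "simple_graph Y" "q \<in> paths Y y y'"
  shows "path_box_right x q = path_map (\<lambda>v\<in>verts Y. (x, v)) q"
  using assms by (auto simp: path_box_right_def path_map_def graph_comp_def compose_def
      paths_iff fun_eq_iff)

lemma paths_endpoints:
  assumes "simple_graph X" "p \<in> paths X x x'"
  shows "x \<in> verts X" "x' \<in> verts X"
  using assms by (auto simp: paths_iff)

lemma farr_Phi:
  assumes X: "simple_graph X" and Y: "simple_graph Y"
    and p: "p \<in> paths X x x'" and q: "q \<in> paths Y y y'"
  shows "farr (Phi X Y) (x, y) (x', y') (path_class X x x' p, path_class Y y y' q) =
         path_class (X \<box> Y) (x, y) (x', y') (path_box_left p y \<star> path_box_right x' q)"
proof -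
  note B = simple_graph_box[OF X Y]
  let ?l = "\<lambda>u\<in>verts X. (u, y)" and ?r = "\<lambda>v\<in>verts Y. (x', v)"
  note e = paths_endpoints[OF X p] paths_endpoints[OF Y q]
  have l: "graph_map X (X \<box> Y) ?l" and r: "graph_map Y (X \<box> Y) ?r"
    using e simple_graphD[OF X] simple_graphD[OF Y] by (auto simp: graph_map_def box_def)
  have lp: "path_box_left a y \<in> paths (X \<box> Y) (x, y) (x', y)" if "a \<in> paths X x x'" for a
    using path_map_in_paths[OF X B l that] path_box_left_eq_map[OF X that, of y] e by simp
  have rp: "path_box_right x' b \<in> paths (X \<box> Y) (x', y) (x', y')" if "b \<in> paths Y y y'" for b
    using path_map_in_paths[OF Y B r that] path_box_right_eq_map[OF Y that, of x'] e by simp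
  have lc: "path_class (X \<box> Y) (x, y) (x', y) (path_box_left a y) =
        path_class (X \<box> Y) (x, y) (x', y) (path_box_left p y)"
    if "a \<in> paths X x x'" "path_class X x x' a = path_class X x x' p" for a
    using path_class_map_cong[OF X B l that(1) p that(2)] e
      path_box_left_eq_map[OF X that(1), of y] path_box_left_eq_map[OF X p, of y] by simp
  have rc: "path_class (X \<box> Y) (x', y) (x', y') (path_box_right x' b) =
        path_class (X \<box> Y) (x', y) (x', y') (path_box_right x' q)"
    if "b \<in> paths Y y y'" "path_class Y y y' b = path_class Y y y' q" for b
    using path_class_map_cong[OF Y B r that(1) q that(2)] e
      path_box_right_eq_map[OF Y that(1), of x'] path_box_right_eq_map[OF Y q, of x'] by simp
  let ?h = "\<lambda>(a, b). path_class (X \<box> Y) (x, y) (x', y') (path_box_left a y \<star> path_box_right x' b)"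
  have "the_elem (?h ` (\<Union>(path_class X x x' p) \<times> \<Union>(path_class Y y y' q))) = ?h (p, q)"
  proof (rule the_elem_image_const)
    show "(p, q) \<in> \<Union>(path_class X x x' p) \<times> \<Union>(path_class Y y y' q)"
      unfolding Union_path_class[OF X p] Union_path_class[OF Y q] using p q by simp
    fix b assume b: "b \<in> \<Union>(path_class X x x' p) \<times> \<Union>(path_class Y y y' q)"
    obtain c d where cd: "b = (c, d)" by (cases b)
    from b have c: "c \<in> paths X x x'" "path_class X x x' c = path_class X x x' p"
      and d: "d \<in> paths Y y y'" "path_class Y y y' d = path_class Y y y' q"
      unfolding cd Union_path_class[OF X p] Union_path_class[OF Y q] by simp_all
    show "?h b = ?h (p, q)"
      unfolding cd split_conv
      by (rule path_class_concat_cong[OF B lp[OF c(1)] lp[OF p] lc[OF c]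
            rp[OF d(1)] rp[OF q] rc[OF d]])
  qed
  then show ?thesis by (simp add: Phi_def)
qed

end

theory Submission
  imports Defs
begin

text \<open>
  \<open>\<Psi>\<close> is a functor because its components are induced by the projections. \<open>\<Phi>\<close> is one because a
  path in \<open>X\<close> can be moved past a path in \<open>Y\<close>, edge by edge. That \<open>\<Psi> \<circ> \<Phi>\<close> is the identity only
  requires removing constant subpaths, and \<open>\<Phi> \<circ> \<Psi>\<close> need only be compared with the identity on
  edges, which generate the fundamental groupoid. The monoidal laws are immediate for the
  projections, hence for \<open>\<Psi>\<close>, and they pass to its inverse \<open>\<Phi>\<close>.
\<close>


section \<open>Functors of groupoids\<close>

definition functor_fst :: "('o \<times> 'p, 'm \<times> 'n, 'o, 'm) fctr" where
  "functor_fst = \<lparr>fobj = fst, farr = (\<lambda>_ _. fst)\<rparr>"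

definition functor_snd :: "('o \<times> 'p, 'm \<times> 'n, 'p, 'n) fctr" where
  "functor_snd = \<lparr>fobj = snd, farr = (\<lambda>_ _. snd)\<rparr>"

lemma functor_eq_refl: "functor_eq G F F"
  by (simp add: functor_eq_def)

lemma functor_eq_sym: "functor_eq G F F' \<Longrightarrow> functor_eq G F' F"
  by (simp add: functor_eq_def)

lemma functor_eq_trans [trans]:
  "functor_eq G F F' \<Longrightarrow> functor_eq G F' F'' \<Longrightarrow> functor_eq G F F''"
  by (simp add: functor_eq_def)

lemma functor_comp_assoc: "(L \<circ>\<^sub>F K) \<circ>\<^sub>F F = L \<circ>\<^sub>F K \<circ>\<^sub>F F"
  by (simp add: functor_comp_def)

lemma functor_comp_id_left: "functor_id \<circ>\<^sub>F F = F"
  by (simp add: functor_comp_def functor_id_def)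

lemma functor_comp_id_right: "F \<circ>\<^sub>F functor_id = F"
  by (simp add: functor_comp_def functor_id_def)

lemma functor_eq_comp_left: "functor_eq G F F' \<Longrightarrow> functor_eq G (K \<circ>\<^sub>F F) (K \<circ>\<^sub>F F')"
  by (simp add: functor_eq_def functor_comp_def)

lemma functor_eq_comp_right:
  "functor_eq H K K' \<Longrightarrow> is_functor G H F \<Longrightarrow> functor_eq G (K \<circ>\<^sub>F F) (K' \<circ>\<^sub>F F)"
  by (simp add: functor_eq_def is_functor_def functor_comp_def)

lemma functor_eq_pair:
  "functor_eq G F F' \<Longrightarrow> functor_eq G K K' \<Longrightarrow> functor_eq G (functor_pair F K) (functor_pair F' K')"
  by (simp add: functor_eq_def functor_pair_def)

lemma functor_eq_prod:
  "functor_eq G F F' \<Longrightarrow> functor_eq H K K' \<Longrightarrow> functor_eq (G \<times>\<^sub>G H) (F \<times>\<^sub>F K) (F' \<times>\<^sub>F K')"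
  by (auto simp: functor_eq_def functor_prod_def gpd_prod_def)

lemma is_functor_id: "is_functor G G functor_id"
  by (simp add: is_functor_def functor_id_def)

lemma is_functor_comp: "is_functor H K F' \<Longrightarrow> is_functor G H F \<Longrightarrow> is_functor G K (F' \<circ>\<^sub>F F)"
  by (simp add: is_functor_def functor_comp_def)

lemma is_functor_pair:
  "is_functor G H F \<Longrightarrow> is_functor G K F' \<Longrightarrow> is_functor G (H \<times>\<^sub>G K) (functor_pair F F')"
  by (simp add: is_functor_def functor_pair_def gpd_prod_def)

lemma is_functor_prod:
  "is_functor G G' F \<Longrightarrow> is_functor H H' K \<Longrightarrow> is_functor (G \<times>\<^sub>G H) (G' \<times>\<^sub>G H') (F \<times>\<^sub>F K)"
  by (auto simp: is_functor_def functor_prod_def gpd_prod_def)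

lemma functor_prod_id: "functor_id \<times>\<^sub>F functor_id = functor_id"
  by (simp add: functor_prod_def functor_id_def fun_eq_iff)

lemma functor_prod_comp: "(F' \<times>\<^sub>F K') \<circ>\<^sub>F (F \<times>\<^sub>F K) = (F' \<circ>\<^sub>F F) \<times>\<^sub>F (K' \<circ>\<^sub>F K)"
  by (simp add: functor_prod_def functor_comp_def fun_eq_iff)

lemma functor_prod_comp_pair:
  "(F' \<times>\<^sub>F K') \<circ>\<^sub>F functor_pair F K = functor_pair (F' \<circ>\<^sub>F F) (K' \<circ>\<^sub>F K)"
  by (simp add: functor_prod_def functor_comp_def functor_pair_def)

lemma functor_pair_comp: "functor_pair F' K' \<circ>\<^sub>F F = functor_pair (F' \<circ>\<^sub>F F) (K' \<circ>\<^sub>F F)"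
  by (simp add: functor_comp_def functor_pair_def)

lemma gpd_assoc_comp_pair:
  "gpd_assoc \<circ>\<^sub>F functor_pair (functor_pair F F') F'' = functor_pair F (functor_pair F' F'')"
  by (simp add: functor_comp_def functor_pair_def gpd_assoc_def)

lemma functor_snd_comp_unit_prod: "functor_snd \<circ>\<^sub>F (F \<times>\<^sub>F functor_id) = gpd_lunit"
  by (simp add: functor_snd_def functor_comp_def functor_prod_def functor_id_def gpd_lunit_def
      fun_eq_iff)

lemma functor_fst_comp_prod_unit: "functor_fst \<circ>\<^sub>F (functor_id \<times>\<^sub>F F) = gpd_runit"
  by (simp add: functor_fst_def functor_comp_def functor_prod_def functor_id_def gpd_runit_def
      fun_eq_iff)

lemma inverse_functors_id: "inverse_functors G G functor_id functor_id"
  by (simp add: inverse_functors_def is_functor_id functor_comp_id_left functor_eq_refl)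

lemma inverse_functors_prod:
  assumes "inverse_functors G G' P Q" "inverse_functors H H' P' Q'"
  shows "inverse_functors (G \<times>\<^sub>G H) (G' \<times>\<^sub>G H') (P \<times>\<^sub>F P') (Q \<times>\<^sub>F Q')"
proof -
  have "functor_eq (G \<times>\<^sub>G H) ((Q \<times>\<^sub>F Q') \<circ>\<^sub>F (P \<times>\<^sub>F P')) functor_id"
    "functor_eq (G' \<times>\<^sub>G H') ((P \<times>\<^sub>F P') \<circ>\<^sub>F (Q \<times>\<^sub>F Q')) functor_id"
    using assms unfolding inverse_functors_def functor_prod_comp functor_prod_id[symmetric]
    by (blast intro: functor_eq_prod)+
  then show ?thesis
    using assms by (simp add: inverse_functors_def is_functor_prod)
qed

lemma functor_eq_comp_inverse:
  assumes "functor_eq G (Q \<circ>\<^sub>F P) functor_id" "functor_eq H (Q' \<circ>\<^sub>F P') functor_id"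
    and "is_functor G H P"
  shows "functor_eq G ((Q \<circ>\<^sub>F Q') \<circ>\<^sub>F (P' \<circ>\<^sub>F P)) functor_id"
proof -
  have "functor_eq G (Q \<circ>\<^sub>F (Q' \<circ>\<^sub>F P') \<circ>\<^sub>F P) (Q \<circ>\<^sub>F functor_id \<circ>\<^sub>F P)"
    by (intro functor_eq_comp_left functor_eq_comp_right[OF assms(2,3)])
  then show ?thesis
    using assms(1) unfolding functor_comp_assoc functor_comp_id_left by (rule functor_eq_trans)
qed

lemma inverse_functors_comp:
  assumes "inverse_functors G H P Q" "inverse_functors H K P' Q'"
  shows "inverse_functors G K (P' \<circ>\<^sub>F P) (Q \<circ>\<^sub>F Q')"
  using assms unfolding inverse_functors_def
  by (blast intro: is_functor_comp functor_eq_comp_inverse)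

lemma inverse_functors_square:
  assumes "inverse_functors G H P Q" and "inverse_functors G' H' P' Q'"
    and F: "is_functor G G' F" and square: "functor_eq G (P' \<circ>\<^sub>F F) (K \<circ>\<^sub>F P)"
  shows "functor_eq H (F \<circ>\<^sub>F Q) (Q' \<circ>\<^sub>F K)"
proof -
  have Q: "is_functor H G Q" and PQ: "functor_eq H (P \<circ>\<^sub>F Q) functor_id"
    and QP': "functor_eq G' (Q' \<circ>\<^sub>F P') functor_id"
    using assms(1,2) by (simp_all add: inverse_functors_def)
  have "functor_eq H (F \<circ>\<^sub>F Q) ((Q' \<circ>\<^sub>F P') \<circ>\<^sub>F F \<circ>\<^sub>F Q)"
    using functor_eq_comp_right[OF QP' is_functor_comp[OF F Q]]
    by (simp add: functor_comp_id_left functor_eq_sym)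
  also have "\<dots> = Q' \<circ>\<^sub>F (P' \<circ>\<^sub>F F) \<circ>\<^sub>F Q"
    by (simp only: functor_comp_assoc)
  also have "functor_eq H (Q' \<circ>\<^sub>F (P' \<circ>\<^sub>F F) \<circ>\<^sub>F Q) (Q' \<circ>\<^sub>F (K \<circ>\<^sub>F P) \<circ>\<^sub>F Q)"
    by (intro functor_eq_comp_left functor_eq_comp_right[OF square Q])
  also have "Q' \<circ>\<^sub>F (K \<circ>\<^sub>F P) \<circ>\<^sub>F Q = Q' \<circ>\<^sub>F K \<circ>\<^sub>F P \<circ>\<^sub>F Q"
    by (simp only: functor_comp_assoc)
  also have "functor_eq H (Q' \<circ>\<^sub>F K \<circ>\<^sub>F P \<circ>\<^sub>F Q) (Q' \<circ>\<^sub>F K \<circ>\<^sub>F functor_id)"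
    by (intro functor_eq_comp_left PQ)
  finally show ?thesis by (simp only: functor_comp_id_right)
qed


section \<open>Paths\<close>

definition path_stall :: "nat \<Rightarrow> 'a \<Rightarrow> 'a path" where
  "path_stall n x = (n, \<lambda>i\<in>verts (interval n). x)"

definition path_edge :: "'a \<Rightarrow> 'a \<Rightarrow> 'a path" where
  "path_edge x y = (1, \<lambda>i\<in>verts (interval 1). if i = 0 then x else y)"

lemma path_const_eq_stall: "path_const x = path_stall 0 x"
  by (simp add: path_const_def path_stall_def)

lemma path_edge_same: "path_edge x x = path_stall 1 x"
  by (auto simp: path_edge_def path_stall_def)

lemma path_stall_in_paths:
  assumes "simple_graph X" "x \<in> verts X"
  shows "path_stall n x \<in> paths X x x"
  using assms by (simp add: paths_iff path_stall_def)

lemma path_edge_in_paths: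
  assumes "simple_graph X" "x \<in> verts X" "y \<in> verts X" "x = y \<or> adj X x y"
  shows "path_edge x y \<in> paths X x y"
  using assms by (auto simp: paths_iff path_edge_def)

lemma path_eqI:
  assumes "simple_graph X" "p \<in> paths X x y" "q \<in> paths X x' y'" "fst p = fst q"
    and "\<And>i. i \<le> fst p \<Longrightarrow> snd p i = snd q i"
  shows "p = q"
proof (rule prod_eqI)
  have "snd p \<in> extensional {..fst p}" "snd q \<in> extensional {..fst p}"
    using assms(2-4) unfolding paths_iff[OF assms(1)] by auto
  then show "snd p = snd q"
    by (rule extensionalityI) (use assms(5) in auto)
qed (rule assms(4))

lemma path_concat_assoc: "(p \<star> q) \<star> r = p \<star> q \<star> r"
  by (auto simp: path_concat_def fun_eq_iff)

lemma path_stall_0_concat: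
  assumes "simple_graph X" "p \<in> paths X x y"
  shows "path_stall 0 x \<star> p = p"
  using assms
  by (auto simp: path_concat_def path_stall_def paths_iff extensional_def fun_eq_iff prod_eq_iff)

lemma path_concat_stall_0:
  assumes "simple_graph X" "p \<in> paths X x y"
  shows "p \<star> path_stall 0 y = p"
  using assms
  by (auto simp: path_concat_def path_stall_def paths_iff extensional_def fun_eq_iff prod_eq_iff)

lemma path_reverse_reverse:
  assumes "simple_graph X" "p \<in> paths X x y"
  shows "path_reverse (path_reverse p) = p"
  using assms
  by (auto simp: path_reverse_def paths_iff extensional_def fun_eq_iff prod_eq_iff)

lemma path_reverse_concat:
  assumes "simple_graph X" "p \<in> paths X x y" "q \<in> paths X y z"
  shows "path_reverse (p \<star> q) = path_reverse q \<star> path_reverse p"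
proof -
  have "snd p (fst p) = snd q 0"
    using assms by (simp add: path_endpoint_eqs)
  then have "snd (path_reverse (p \<star> q)) i = snd (path_reverse q \<star> path_reverse p) i" for i
    by (cases i "fst q" rule: linorder_cases)
      (auto simp: path_reverse_def path_concat_def add.commute)
  then show ?thesis
    by (auto simp: prod_eq_iff path_reverse_def path_concat_def)
qed

lemma path_reverse_stall: "path_reverse (path_stall n x) = path_stall n x"
  by (auto simp: path_reverse_def path_stall_def)

lemma path_reverse_edge: "path_reverse (path_edge x y) = path_edge y x"
  by (auto simp: path_reverse_def path_edge_def)

lemma path_map_concat: "path_map f (p \<star> q) = path_map f p \<star> path_map f q"
  by (auto simp: path_map_def path_concat_def graph_comp_def compose_def fun_eq_iff)

lemma path_map_stall: "path_map f (path_stall n x) = path_stall n (f x)"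
  by (auto simp: path_map_def path_stall_def graph_comp_def compose_def fun_eq_iff)

lemma path_map_edge: "path_map f (path_edge x y) = path_edge (f x) (f y)"
  by (auto simp: path_map_def path_edge_def graph_comp_def compose_def fun_eq_iff)

lemma path_map_path_map: "path_map g (path_map f p) = path_map (\<lambda>x. g (f x)) p"
  by (auto simp: path_map_def graph_comp_def compose_def fun_eq_iff)

lemma path_map_constant: "path_map (\<lambda>_. x) p = path_stall (fst p) x"
  by (auto simp: path_map_def path_stall_def graph_comp_def compose_def)

lemma path_map_ident:
  assumes "simple_graph X" "p \<in> paths X x y"
  shows "path_map (\<lambda>v. v) p = p"
  using assms
  by (auto simp: path_map_def graph_comp_def compose_def paths_iff extensional_def
      fun_eq_iff prod_eq_iff)

lemma path_map_restrict:
  assumes "simple_graph X" "p \<in> paths X x y"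
  shows "path_map (restrict f (verts X)) p = path_map f p"
  using assms by (auto simp: path_map_def graph_comp_def compose_def fun_eq_iff paths_iff)

lemma path_split_last:
  assumes X: "simple_graph X" and p: "p \<in> paths X x y" and n: "fst p = Suc n"
  obtains q z where "q \<in> paths X x z" "fst q = n" "z = y \<or> adj X z y" "p = q \<star> path_edge z y"
proof -
  let ?q = "(n, restrict (snd p) {..n})" and ?z = "snd p n"
  have q: "?q \<in> paths X x ?z" and edge: "?z = y \<or> adj X ?z y" and z: "?z \<in> verts X"
    using p n unfolding paths_iff[OF X] by auto
  note y = paths_endpoints(2)[OF X p]
  have "p = ?q \<star> path_edge ?z y"
    by (rule path_eqI[OF X p path_concat_in_paths[OF X q path_edge_in_paths[OF X z y edge]]])
      (use n path_endpoint_eqs(2)[OF X p] in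
        \<open>auto simp: path_concat_def path_edge_def le_Suc_eq\<close>)
  then show thesis using that[OF q _ edge] by simp
qed

lemma path_induct [consumes 2, case_names const snoc]:
  assumes X: "simple_graph X" and "p \<in> paths X x y"
    and const: "P x (path_const x)"
    and snoc: "\<And>p z y. p \<in> paths X x z \<Longrightarrow> y \<in> verts X \<Longrightarrow> z = y \<or> adj X z y \<Longrightarrow>
      P z p \<Longrightarrow> P y (p \<star> path_edge z y)"
  shows "P y p"
  using assms(2)
proof (induction "fst p" arbitrary: p y)
  case 0
  then have "p = path_stall 0 x" and "y = x"
    by (auto simp: paths_iff[OF X] path_stall_def prod_eq_iff extensional_def fun_eq_iff)
  then show ?case using const by (simp add: path_const_eq_stall)
next
  case (Suc n)
  obtain q z where q: "q \<in> paths X x z" "fst q = n" and edge: "z = y \<or> adj X z y"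
    and p: "p = q \<star> path_edge z y"
    by (rule path_split_last[OF X Suc(3) Suc(2)[symmetric]])
  have "P z q" using Suc(1) q by blast
  then show ?case
    unfolding p by (rule snoc[OF q(1) paths_endpoints(2)[OF X Suc(3)] edge])
qed


section \<open>Homotopy of paths\<close>

definition path_homotopic :: "'a pregraph \<Rightarrow> 'a \<Rightarrow> 'a \<Rightarrow> 'a path \<Rightarrow> 'a path \<Rightarrow> bool" where
  "path_homotopic X x y p q \<longleftrightarrow>
     p \<in> paths X x y \<and> q \<in> paths X x y \<and> path_class X x y p = path_class X x y q"

lemma path_homotopic_refl: "p \<in> paths X x y \<Longrightarrow> path_homotopic X x y p p"
  by (simp add: path_homotopic_def)

lemma path_homotopic_sym: "path_homotopic X x y p q \<Longrightarrow> path_homotopic X x y q p"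
  by (simp add: path_homotopic_def)

lemma path_homotopic_trans [trans]:
  "path_homotopic X x y p q \<Longrightarrow> path_homotopic X x y q r \<Longrightarrow> path_homotopic X x y p r"
  by (simp add: path_homotopic_def)

lemma path_homotopic_concat:
  assumes "simple_graph X" "path_homotopic X x y p p'" "path_homotopic X y z q q'"
  shows "path_homotopic X x z (p \<star> q) (p' \<star> q')"
  using assms unfolding path_homotopic_def
  by (metis path_concat_in_paths path_class_concat_cong)

lemma path_homotopic_close:
  assumes "simple_graph X" "p \<in> paths X x y" "q \<in> paths X x y" "fst p = fst q"
    and "\<And>i. i \<le> fst p \<Longrightarrow> snd p i = snd q i \<or> adj X (snd p i) (snd q i)"
  shows "path_homotopic X x y p q"
  using assms path_class_eqI_close[OF assms] by (simp add: path_homotopic_def)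

lemma path_homotopic_stall:
  assumes X: "simple_graph X" and x: "x \<in> verts X"
  shows "path_homotopic X x x (path_stall m x) (path_stall n x)"
proof -
  have "path_class X x x (path_stall 0 x) = path_class X x x (path_stall k x)" for k
    by (rule path_class_eqI_reparam[OF X path_stall_in_paths[OF X x] path_stall_in_paths[OF X x],
          where s = "\<lambda>i\<in>{..k}. 0"])
      (simp_all add: shrinking_iff path_stall_def)
  then show ?thesis
    using path_stall_in_paths[OF X x] by (metis path_homotopic_def)
qed

lemma path_homotopic_concat_stall:
  assumes X: "simple_graph X" and p: "p \<in> paths X x y"
  shows "path_homotopic X x y (p \<star> path_stall n y) p"
  using path_homotopic_concat[OF X path_homotopic_refl[OF p]
      path_homotopic_stall[OF X paths_endpoints(2)[OF X p], of n 0]]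
  by (simp add: path_concat_stall_0[OF X p])

lemma path_homotopic_stall_concat:
  assumes X: "simple_graph X" and p: "p \<in> paths X x y"
  shows "path_homotopic X x y (path_stall n x \<star> p) p"
  using path_homotopic_concat[OF X path_homotopic_stall[OF X paths_endpoints(1)[OF X p], of n 0]
      path_homotopic_refl[OF p]]
  by (simp add: path_stall_0_concat[OF X p])

lemma path_homotopic_of_delayed:
  assumes X: "simple_graph X" and p: "p \<in> paths X x y" and q: "q \<in> paths X x y"
    and delayed: "path_homotopic X x y (p \<star> path_stall m y) (path_stall n x \<star> q)"
  shows "path_homotopic X x y p q"
  using path_homotopic_concat_stall[OF X p] delayed path_homotopic_stall_concat[OF X q]
  by (metis path_homotopic_sym path_homotopic_trans)

lemma path_homotopic_edge_backtrack:
  assumes X: "simple_graph X" and xy: "x \<in> verts X" "y \<in> verts X" "x = y \<or> adj X x y"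
  shows "path_homotopic X x x (path_edge x y \<star> path_edge y x) (path_stall 2 x)"
proof -
  have yx: "y = x \<or> adj X y x"
    using xy(3) simple_graphD(4)[OF X] by blast
  have "path_edge x y \<star> path_edge y x \<in> paths X x x"
    using path_concat_in_paths[OF X path_edge_in_paths[OF X xy]
        path_edge_in_paths[OF X xy(2,1) yx]] .
  then show ?thesis
    using yx by (intro path_homotopic_close[OF X _ path_stall_in_paths[OF X xy(1)]])
      (auto simp: path_concat_def path_edge_def path_stall_def)
qed

lemma path_homotopic_concat_reverse:
  assumes X: "simple_graph X" and p: "p \<in> paths X x y"
  shows "path_homotopic X x x (p \<star> path_reverse p) (path_const x)"
  using X p
proof (induction rule: path_induct)
  case const
  show ?case
    using path_homotopic_stall[OF X paths_endpoints(1)[OF X p], of 0 0]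
      path_stall_0_concat[OF X path_stall_in_paths[OF X paths_endpoints(1)[OF X p]]]
    by (simp add: path_const_eq_stall path_reverse_stall)
next
  case (snoc p z y)
  let ?e = "path_edge z y" and ?e' = "path_edge y z"
  have z: "z \<in> verts X" and r: "path_reverse p \<in> paths X z x"
    using paths_endpoints(2)[OF X snoc(1)] path_reverse_in_paths[OF X snoc(1)] by blast+
  have "(p \<star> ?e) \<star> path_reverse (p \<star> ?e) = p \<star> (?e \<star> ?e') \<star> path_reverse p"
    using path_reverse_concat[OF X snoc(1) path_edge_in_paths[OF X z snoc(2,3)]]
    by (simp add: path_reverse_edge path_concat_assoc)
  also have "path_homotopic X x x \<dots> (p \<star> path_stall 2 z \<star> path_reverse p)"
    by (rule path_homotopic_concat[OF X path_homotopic_refl[OF snoc(1)] path_homotopic_concat[OF X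
          path_homotopic_edge_backtrack[OF X z snoc(2,3)] path_homotopic_refl[OF r]]])
  also have "path_homotopic X x x \<dots> (p \<star> path_reverse p)"
    by (rule path_homotopic_concat[OF X path_homotopic_refl[OF snoc(1)]
          path_homotopic_stall_concat[OF X r]])
  also note snoc(4)
  finally show ?case .
qed


section \<open>Paths in box products\<close>

lemma verts_box: "verts (X \<box> Y) = verts X \<times> verts Y"
  by (simp add: box_def)

lemma adj_box:
  "adj (X \<box> Y) (x, y) (x', y') \<longleftrightarrow>
     adj X x x' \<and> y = y' \<and> y \<in> verts Y \<or> x = x' \<and> x \<in> verts X \<and> adj Y y y'"
  by (simp add: box_def)

lemma path_box_left_conv_map: "path_box_left p y = path_map (\<lambda>x. (x, y)) p"
  by (simp add: path_box_left_def path_map_def graph_comp_def compose_def)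

lemma path_box_right_conv_map: "path_box_right x q = path_map (Pair x) q"
  by (simp add: path_box_right_def path_map_def graph_comp_def compose_def)

lemma path_box_left_in_paths:
  assumes "simple_graph X" "simple_graph Y" "p \<in> paths X x x'" "y \<in> verts Y"
  shows "path_box_left p y \<in> paths (X \<box> Y) (x, y) (x', y)"
  using assms by (auto simp: paths_iff simple_graph_box path_box_left_def verts_box adj_box)

lemma path_box_right_in_paths:
  assumes "simple_graph X" "simple_graph Y" "q \<in> paths Y y y'" "x \<in> verts X"
  shows "path_box_right x q \<in> paths (X \<box> Y) (x, y) (x, y')"
  using assms by (auto simp: paths_iff simple_graph_box path_box_right_def verts_box adj_box)

lemma path_box_in_paths:
  assumes X: "simple_graph X" and Y: "simple_graph Y"
    and p: "p \<in> paths X x x'" and q: "q \<in> paths Y y y'"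
  shows "path_box_left p y \<star> path_box_right x' q \<in> paths (X \<box> Y) (x, y) (x', y')"
  by (rule path_concat_in_paths[OF simple_graph_box[OF X Y]
        path_box_left_in_paths[OF X Y p paths_endpoints(1)[OF Y q]]
        path_box_right_in_paths[OF X Y q paths_endpoints(2)[OF X p]]])

lemma path_box_left_concat: "path_box_left (p \<star> q) y = path_box_left p y \<star> path_box_left q y"
  by (simp only: path_box_left_conv_map path_map_concat)

lemma path_box_right_concat: "path_box_right x (p \<star> q) = path_box_right x p \<star> path_box_right x q"
  by (simp only: path_box_right_conv_map path_map_concat)

lemma path_box_left_stall: "path_box_left (path_stall n x) y = path_stall n (x, y)"
  by (simp only: path_box_left_conv_map path_map_stall)

lemma path_box_right_stall: "path_box_right x (path_stall n y) = path_stall n (x, y)"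
  by (simp only: path_box_right_conv_map path_map_stall)

lemma path_map_fst_box:
  assumes "simple_graph X" "p \<in> paths X x x'"
  shows "path_map fst (path_box_left p y \<star> path_box_right x' q) = p \<star> path_stall (fst q) x'"
  by (simp add: path_box_left_conv_map path_box_right_conv_map path_map_concat path_map_path_map
      path_map_constant path_map_ident[OF assms])

lemma path_map_snd_box:
  assumes "simple_graph Y" "q \<in> paths Y y y'"
  shows "path_map snd (path_box_left p y \<star> path_box_right x' q) = path_stall (fst p) y \<star> q"
  by (simp add: path_box_left_conv_map path_box_right_conv_map path_map_concat path_map_path_map
      path_map_constant path_map_ident[OF assms])

text \<open>The two ways around the rectangle are not pointwise adjacent, but they become so after
  delaying one of them by a step at its start and the other by a step at its end.\<close>

lemma path_homotopic_box_edge_interchange: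
  assumes X: "simple_graph X" and Y: "simple_graph Y"
    and x: "x \<in> verts X" "x' \<in> verts X" "x = x' \<or> adj X x x'" and q: "q \<in> paths Y y y'"
  shows "path_homotopic (X \<box> Y) (x, y) (x', y')
    (path_box_left (path_edge x x') y \<star> path_box_right x' q)
    (path_box_right x q \<star> path_box_left (path_edge x x') y')"
    (is "path_homotopic _ _ _ ?edge_first ?edge_last")
proof -
  note XY = simple_graph_box[OF X Y] and edge = path_edge_in_paths[OF X x]
  have first: "?edge_first \<in> paths (X \<box> Y) (x, y) (x', y')"
    by (rule path_box_in_paths[OF X Y edge q])
  have last: "?edge_last \<in> paths (X \<box> Y) (x, y) (x', y')"
    by (rule path_concat_in_paths[OF XY path_box_right_in_paths[OF X Y q x(1)]
          path_box_left_in_paths[OF X Y edge paths_endpoints(2)[OF Y q]]])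
  let ?p = "?edge_first \<star> path_stall 1 (x', y')" and ?q = "path_stall 1 (x, y) \<star> ?edge_last"
  note path_defs = path_concat_def path_box_left_def path_box_right_def path_stall_def path_edge_def
  show ?thesis
  proof (rule path_homotopic_of_delayed[OF XY first last], rule path_homotopic_close[OF XY])
    show "?p \<in> paths (X \<box> Y) (x, y) (x', y')" "?q \<in> paths (X \<box> Y) (x, y) (x', y')"
      using path_homotopic_concat_stall[OF XY first] path_homotopic_stall_concat[OF XY last]
      by (simp_all add: path_homotopic_def)
    show "fst ?p = fst ?q" by (simp add: path_defs)
    fix i assume "i \<le> fst ?p"
    then have "i \<le> Suc (Suc (fst q))" by (simp add: path_defs)
    then consider (start) "i = 0" | (across) j where "i = Suc j" "j \<le> fst q"
      | (finish) "i = Suc (Suc (fst q))"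
      by (metis le_SucE not0_implies_Suc Suc_le_mono)
    then show "snd ?p i = snd ?q i \<or> adj (X \<box> Y) (snd ?p i) (snd ?q i)"
    proof cases
      case (across j)
      then have "snd ?p i = (x', snd q j)" "snd ?q i = (x, snd q j)" "snd q j \<in> verts Y"
        using q by (auto simp: path_defs paths_iff[OF Y])
      then show ?thesis using x(3) simple_graphD(4)[OF X] by (auto simp: adj_box)
    qed (use path_endpoint_eqs[OF Y q] in \<open>auto simp: path_defs\<close>)
  qed
qed

lemma path_homotopic_box_interchange:
  assumes X: "simple_graph X" and Y: "simple_graph Y"
    and p: "p \<in> paths X x x'" and q: "q \<in> paths Y y y'"
  shows "path_homotopic (X \<box> Y) (x, y) (x', y')
    (path_box_left p y \<star> path_box_right x' q) (path_box_right x q \<star> path_box_left p y')"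
  using X p
proof (induction rule: path_induct)
  case const
  note XY = simple_graph_box[OF X Y]
  have "path_box_right x q \<in> paths (X \<box> Y) (x, y) (x, y')"
    using path_box_right_in_paths[OF X Y q paths_endpoints(1)[OF X p]] .
  then show ?case
    by (simp add: path_const_eq_stall path_box_left_stall path_stall_0_concat[OF XY]
        path_concat_stall_0[OF XY] path_homotopic_refl)
next
  case (snoc p z x')
  note XY = simple_graph_box[OF X Y] and z = paths_endpoints(2)[OF X snoc(1)]
    and y = paths_endpoints[OF Y q]
  let ?e = "path_edge z x'"
  have "path_box_left (p \<star> ?e) y \<star> path_box_right x' q =
      path_box_left p y \<star> path_box_left ?e y \<star> path_box_right x' q"
    by (simp only: path_box_left_concat path_concat_assoc)
  also have "path_homotopic (X \<box> Y) (x, y) (x', y') \<dots>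
      (path_box_left p y \<star> path_box_right z q \<star> path_box_left ?e y')"
    by (rule path_homotopic_concat[OF XY
          path_homotopic_refl[OF path_box_left_in_paths[OF X Y snoc(1) y(1)]]
          path_homotopic_box_edge_interchange[OF X Y z snoc(2,3) q]])
  also have "path_box_left p y \<star> path_box_right z q \<star> path_box_left ?e y' =
      (path_box_left p y \<star> path_box_right z q) \<star> path_box_left ?e y'"
    by (simp only: path_concat_assoc)
  also have "path_homotopic (X \<box> Y) (x, y) (x', y') \<dots>
      ((path_box_right x q \<star> path_box_left p y') \<star> path_box_left ?e y')"
    by (rule path_homotopic_concat[OF XY snoc(4) path_homotopic_refl[OF
            path_box_left_in_paths[OF X Y path_edge_in_paths[OF X z snoc(2,3)] y(2)]]])
  also have "(path_box_right x q \<star> path_box_left p y') \<star> path_box_left ?e y' =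
      path_box_right x q \<star> path_box_left (p \<star> ?e) y'"
    by (simp only: path_box_left_concat path_concat_assoc)
  finally show ?case .
qed

lemma path_homotopic_box_concat:
  assumes X: "simple_graph X" and Y: "simple_graph Y"
    and p: "p \<in> paths X x x'" "p' \<in> paths X x' x''"
    and q: "q \<in> paths Y y y'" "q' \<in> paths Y y' y''"
  shows "path_homotopic (X \<box> Y) (x, y) (x'', y'')
    (path_box_left (p \<star> p') y \<star> path_box_right x'' (q \<star> q'))
    ((path_box_left p y \<star> path_box_right x' q) \<star> path_box_left p' y' \<star> path_box_right x'' q')"
proof -
  note XY = simple_graph_box[OF X Y]
  have "path_homotopic (X \<box> Y) (x, y) (x'', y'')
      (path_box_left p y \<star> (path_box_left p' y \<star> path_box_right x'' q) \<star> path_box_right x'' q')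
      (path_box_left p y \<star> (path_box_right x' q \<star> path_box_left p' y') \<star> path_box_right x'' q')"
    by (rule path_homotopic_concat[OF XY path_homotopic_refl path_homotopic_concat[OF XY
            path_homotopic_box_interchange[OF X Y p(2) q(1)] path_homotopic_refl]])
      (simp_all add: path_box_left_in_paths[OF X Y] path_box_right_in_paths[OF X Y] p q
        paths_endpoints[OF X p(2)] paths_endpoints[OF Y q(1)])
  then show ?thesis
    by (simp only: path_box_left_concat path_box_right_concat path_concat_assoc)
qed

lemma path_homotopic_box_edge:
  assumes X: "simple_graph X" and Y: "simple_graph Y" and adj: "adj (X \<box> Y) (x, y) (x', y')"
  shows "path_homotopic (X \<box> Y) (x, y) (x', y')
    (path_box_left (path_edge x x') y \<star> path_box_right x' (path_edge y y'))
    (path_edge (x, y) (x', y'))"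
proof -
  note XY = simple_graph_box[OF X Y]
  have edge: "path_edge (x, y) (x', y') \<in> paths (X \<box> Y) (x, y) (x', y')"
    using path_edge_in_paths[OF XY simple_graphD(1,2)[OF XY adj]] adj by blast
  have left_edge: "path_box_left (path_edge x x') y = path_edge (x, y) (x', y)"
    and right_edge: "path_box_right x' (path_edge y y') = path_edge (x', y) (x', y')"
    by (simp_all only: path_box_left_conv_map path_box_right_conv_map path_map_edge)
  consider (left) "y = y'" | (right) "x = x'"
    using adj by (auto simp: adj_box)
  then show ?thesis
  proof cases
    case left
    then show ?thesis
      using path_homotopic_concat_stall[OF XY edge] unfolding left_edge right_edge
      by (simp add: path_edge_same)
  next
    case right
    then show ?thesis
      using path_homotopic_stall_concat[OF XY edge] unfolding left_edge right_edge
      by (simp add: path_edge_same)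
  qed
qed


section \<open>The fundamental groupoid functor\<close>

lemma Ob_Pi1: "Ob (Pi1 X) = verts X"
  by (simp add: Pi1_def)

lemma Ident_Pi1: "Ident (Pi1 X) x = path_class X x x (path_const x)"
  by (simp add: Pi1_def)

lemma Hom_Pi1E:
  assumes "a \<in> Hom (Pi1 X) x y"
  obtains p where "p \<in> paths X x y" "a = path_class X x y p"
  using assms unfolding Hom_Pi1 by blast

lemma path_class_in_Hom: "p \<in> paths X x y \<Longrightarrow> path_class X x y p \<in> Hom (Pi1 X) x y"
  unfolding Hom_Pi1 by blast

lemma path_class_eqI_homotopic:
  "path_homotopic X x y p q \<Longrightarrow> path_class X x y p = path_class X x y q"
  by (simp add: path_homotopic_def)

lemma path_const_in_paths: "simple_graph X \<Longrightarrow> x \<in> verts X \<Longrightarrow> path_const x \<in> paths X x x"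
  by (simp add: path_const_eq_stall path_stall_in_paths)

lemma path_class_edge_same:
  assumes "simple_graph X" "x \<in> verts X"
  shows "path_class X x x (path_edge x x) = Ident (Pi1 X) x"
  using path_class_eqI_homotopic[OF path_homotopic_stall[OF assms]]
  unfolding path_edge_same Ident_Pi1 path_const_eq_stall .

lemma Comp_Pi1_Ident_left:
  assumes X: "simple_graph X" and p: "p \<in> paths X x y"
  shows "Comp (Pi1 X) x y y (Ident (Pi1 X) y) (path_class X x y p) = path_class X x y p"
  unfolding Ident_Pi1 path_const_eq_stall
    Comp_Pi1[OF X p path_stall_in_paths[OF X paths_endpoints(2)[OF X p]]]
    path_concat_stall_0[OF X p] ..

lemma Comp_Pi1_Ident_right:
  assumes X: "simple_graph X" and p: "p \<in> paths X x y"
  shows "Comp (Pi1 X) x x y (path_class X x y p) (Ident (Pi1 X) x) = path_class X x y p"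
  unfolding Ident_Pi1 path_const_eq_stall
    Comp_Pi1[OF X path_stall_in_paths[OF X paths_endpoints(1)[OF X p]] p]
    path_stall_0_concat[OF X p] ..

lemma Comp_Pi1_reverse_left:
  assumes X: "simple_graph X" and p: "p \<in> paths X x y"
  shows "Comp (Pi1 X) x y x (path_class X y x (path_reverse p)) (path_class X x y p) =
    Ident (Pi1 X) x"
  unfolding Comp_Pi1[OF X p path_reverse_in_paths[OF X p]] Ident_Pi1
  by (rule path_class_eqI_homotopic[OF path_homotopic_concat_reverse[OF X p]])

lemma Comp_Pi1_reverse_right:
  assumes X: "simple_graph X" and p: "p \<in> paths X x y"
  shows "Comp (Pi1 X) y x y (path_class X x y p) (path_class X y x (path_reverse p)) =
    Ident (Pi1 X) y"
  using Comp_Pi1_reverse_left[OF X path_reverse_in_paths[OF X p]]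
  unfolding path_reverse_reverse[OF X p] .

lemma groupoid_Pi1:
  assumes X: "simple_graph X"
  shows "groupoid (Pi1 X)"
  unfolding groupoid_def Ob_Pi1
proof (intro conjI ballI; (elim Hom_Pi1E)?)
  fix x assume x: "x \<in> verts X"
  show "Ident (Pi1 X) x \<in> Hom (Pi1 X) x x"
    unfolding Ident_Pi1 by (rule path_class_in_Hom[OF path_const_in_paths[OF X x]])
next
  fix x y z a b p q
  assume p: "p \<in> paths X x y" and q: "q \<in> paths X y z"
    and ab: "a = path_class X x y p" "b = path_class X y z q"
  show "Comp (Pi1 X) x y z b a \<in> Hom (Pi1 X) x z"
    unfolding ab Comp_Pi1[OF X p q] by (rule path_class_in_Hom[OF path_concat_in_paths[OF X p q]])
next
  fix x y a p
  assume p: "p \<in> paths X x y" and a: "a = path_class X x y p"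
  show "Comp (Pi1 X) x x y a (Ident (Pi1 X) x) = a"
    unfolding a by (rule Comp_Pi1_Ident_right[OF X p])
  show "Comp (Pi1 X) x y y (Ident (Pi1 X) y) a = a"
    unfolding a by (rule Comp_Pi1_Ident_left[OF X p])
  show "Inv (Pi1 X) x y a \<in> Hom (Pi1 X) y x"
    unfolding a Inv_Pi1[OF X p] by (rule path_class_in_Hom[OF path_reverse_in_paths[OF X p]])
  show "Comp (Pi1 X) x y x (Inv (Pi1 X) x y a) a = Ident (Pi1 X) x"
    unfolding a Inv_Pi1[OF X p] by (rule Comp_Pi1_reverse_left[OF X p])
  show "Comp (Pi1 X) y x y a (Inv (Pi1 X) x y a) = Ident (Pi1 X) y"
    unfolding a Inv_Pi1[OF X p] by (rule Comp_Pi1_reverse_right[OF X p])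
next
  fix w x y z a b c p q r
  assume p: "p \<in> paths X w x" and q: "q \<in> paths X x y" and r: "r \<in> paths X y z"
    and abc: "a = path_class X w x p" "b = path_class X x y q" "c = path_class X y z r"
  show "Comp (Pi1 X) w x z (Comp (Pi1 X) x y z c b) a =
      Comp (Pi1 X) w y z c (Comp (Pi1 X) w x y b a)"
    by (simp only: abc Comp_Pi1[OF X] p q r path_concat_in_paths[OF X p q]
        path_concat_in_paths[OF X q r] path_concat_assoc)
qed

lemma farr_Ident_Pi1:
  assumes "is_functor (Pi1 X) G F" "x \<in> verts X"
  shows "farr F x x (Ident (Pi1 X) x) = Ident G (fobj F x)"
  using assms by (simp add: is_functor_def Ob_Pi1)

lemma farr_path_class_concat:
  assumes X: "simple_graph X" and F: "is_functor (Pi1 X) G F"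
    and p: "p \<in> paths X x y" and q: "q \<in> paths X y z"
  shows "farr F x z (path_class X x z (p \<star> q)) =
    Comp G (fobj F x) (fobj F y) (fobj F z)
      (farr F y z (path_class X y z q)) (farr F x y (path_class X x y p))"
  using F path_class_in_Hom[OF p] path_class_in_Hom[OF q] paths_endpoints[OF X p]
    paths_endpoints[OF X q]
  by (simp add: is_functor_def Ob_Pi1 flip: Comp_Pi1[OF X p q])

lemma functor_eq_Pi1I_on_edges:
  assumes X: "simple_graph X" and F: "is_functor (Pi1 X) G F" and K: "is_functor (Pi1 X) G K"
    and verts: "\<And>x. x \<in> verts X \<Longrightarrow> fobj F x = fobj K x"
    and edges: "\<And>x y. adj X x y \<Longrightarrow>
      farr F x y (path_class X x y (path_edge x y)) = farr K x y (path_class X x y (path_edge x y))"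
  shows "functor_eq (Pi1 X) F K"
  unfolding functor_eq_def Ob_Pi1
proof (intro conjI ballI; (elim Hom_Pi1E)?)
  have idents: "farr F x x (Ident (Pi1 X) x) = farr K x x (Ident (Pi1 X) x)"
    if "x \<in> verts X" for x
    using that by (simp add: farr_Ident_Pi1[OF F] farr_Ident_Pi1[OF K] verts)
  fix x y a p assume x: "x \<in> verts X" and p: "p \<in> paths X x y" and a: "a = path_class X x y p"
  from X p have "farr F x y (path_class X x y p) = farr K x y (path_class X x y p)"
  proof (induction rule: path_induct)
    case const
    show ?case using idents[OF x] unfolding Ident_Pi1 .
  next
    case (snoc p z y)
    note z = paths_endpoints(2)[OF X snoc(1)]
    note edge = path_edge_in_paths[OF X z snoc(2,3)]
    have "farr F z y (path_class X z y (path_edge z y)) =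
        farr K z y (path_class X z y (path_edge z y))"
      using snoc(3) edges idents[OF z] path_class_edge_same[OF X z] by metis
    then show ?case
      using snoc(4) by (simp add: farr_path_class_concat[OF X F snoc(1) edge]
          farr_path_class_concat[OF X K snoc(1) edge] verts x z snoc(2))
  qed
  then show "farr F x y a = farr K x y a" unfolding a .
qed (rule verts)

lemma fobj_Pi1_map: "fobj (Pi1_map Y f) = f"
  by (simp add: Pi1_map_def)

lemma graph_map_verts: "graph_map X Y f \<Longrightarrow> x \<in> verts X \<Longrightarrow> f x \<in> verts Y"
  by (auto simp: graph_map_def)

lemma farr_Pi1_map_restrict:
  assumes X: "simple_graph X" and Y: "simple_graph Y"
    and f: "graph_map X Y (restrict f (verts X))" and p: "p \<in> paths X x y"
  shows "farr (Pi1_map Y (restrict f (verts X))) x y (path_class X x y p) =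
    path_class Y (f x) (f y) (path_map f p)"
  using paths_endpoints[OF X p] by (simp add: farr_Pi1_map[OF assms] path_map_restrict[OF X p])

lemma is_functor_Pi1_map:
  assumes X: "simple_graph X" and Y: "simple_graph Y" and f: "graph_map X Y f"
  shows "is_functor (Pi1 X) (Pi1 Y) (Pi1_map Y f)"
  unfolding is_functor_def Ob_Pi1 fobj_Pi1_map
proof (intro conjI ballI; (elim Hom_Pi1E)?)
  fix x assume x: "x \<in> verts X"
  show "f x \<in> verts Y" by (rule graph_map_verts[OF f x])
  show "farr (Pi1_map Y f) x x (Ident (Pi1 X) x) = Ident (Pi1 Y) (f x)"
    unfolding Ident_Pi1 farr_Pi1_map[OF X Y f path_const_in_paths[OF X x]]
    by (simp add: path_const_eq_stall path_map_stall)
next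
  fix x y a p assume p: "p \<in> paths X x y" and a: "a = path_class X x y p"
  show "farr (Pi1_map Y f) x y a \<in> Hom (Pi1 Y) (f x) (f y)"
    unfolding a farr_Pi1_map[OF X Y f p]
    by (rule path_class_in_Hom[OF path_map_in_paths[OF X Y f p]])
next
  fix x y z a b p q
  assume p: "p \<in> paths X x y" and q: "q \<in> paths X y z"
    and ab: "a = path_class X x y p" "b = path_class X y z q"
  show "farr (Pi1_map Y f) x z (Comp (Pi1 X) x y z b a) =
      Comp (Pi1 Y) (f x) (f y) (f z) (farr (Pi1_map Y f) y z b) (farr (Pi1_map Y f) x y a)"
    unfolding ab Comp_Pi1[OF X p q] farr_Pi1_map[OF X Y f p] farr_Pi1_map[OF X Y f q]
      farr_Pi1_map[OF X Y f path_concat_in_paths[OF X p q]] path_map_concat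
      Comp_Pi1[OF Y path_map_in_paths[OF X Y f p] path_map_in_paths[OF X Y f q]] ..
qed

lemma graph_map_id: "simple_graph X \<Longrightarrow> graph_map X X (graph_id X)"
  using simple_graphD by (fastforce simp: graph_map_def graph_id_def)

lemma graph_map_comp:
  assumes "simple_graph X" "graph_map X Y f" "graph_map Y Z g"
  shows "graph_map X Z (graph_comp X g f)"
proof -
  have "g (f x) = g (f y) \<or> adj Z (g (f x)) (g (f y))" if "adj X x y" for x y
    using assms(2,3) that unfolding graph_map_def by metis
  then show ?thesis
    using assms(2,3) simple_graphD[OF assms(1)]
    by (auto simp: graph_map_def graph_comp_def compose_def)
qed

lemma Pi1_map_id:
  assumes X: "simple_graph X"
  shows "functor_eq (Pi1 X) (Pi1_map X (graph_id X)) functor_id"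
  unfolding functor_eq_def Ob_Pi1
proof (intro conjI ballI; (elim Hom_Pi1E)?)
  fix x y a p assume p: "p \<in> paths X x y" and a: "a = path_class X x y p"
  show "farr (Pi1_map X (graph_id X)) x y a = farr functor_id x y a"
    using farr_Pi1_map_restrict[OF X X graph_map_id[OF X, unfolded graph_id_def] p]
    by (simp add: a functor_id_def graph_id_def path_map_ident[OF X p])
qed (simp add: fobj_Pi1_map functor_id_def graph_id_def)

lemma Pi1_map_comp:
  assumes X: "simple_graph X" and Y: "simple_graph Y" and Z: "simple_graph Z"
    and f: "graph_map X Y f" and g: "graph_map Y Z g"
  shows "functor_eq (Pi1 X) (Pi1_map Z (graph_comp X g f)) (Pi1_map Z g \<circ>\<^sub>F Pi1_map Y f)"
  unfolding functor_eq_def Ob_Pi1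
proof (intro conjI ballI; (elim Hom_Pi1E)?)
  fix x y a p assume p: "p \<in> paths X x y" and a: "a = path_class X x y p"
  have gf: "graph_comp X g f = restrict (\<lambda>x. g (f x)) (verts X)"
    by (simp add: graph_comp_def compose_def)
  show "farr (Pi1_map Z (graph_comp X g f)) x y a = farr (Pi1_map Z g \<circ>\<^sub>F Pi1_map Y f) x y a"
    using farr_Pi1_map_restrict[OF X Z graph_map_comp[OF X f g, unfolded gf] p]
    by (simp add: a gf functor_comp_def fobj_Pi1_map farr_Pi1_map[OF X Y f p]
        farr_Pi1_map[OF Y Z g path_map_in_paths[OF X Y f p]] path_map_path_map)
qed (simp add: fobj_Pi1_map functor_comp_def graph_comp_def compose_def)

lemma Pi1_map_square:
  assumes X: "simple_graph X" and Y: "simple_graph Y" and Y': "simple_graph Y'"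
    and Z: "simple_graph Z"
    and maps: "graph_map X Y f" "graph_map Y Z g" "graph_map X Y' f'" "graph_map Y' Z g'"
    and square: "graph_comp X g f = graph_comp X g' f'"
  shows "functor_eq (Pi1 X) (Pi1_map Z g \<circ>\<^sub>F Pi1_map Y f) (Pi1_map Z g' \<circ>\<^sub>F Pi1_map Y' f')"
  using functor_eq_trans[OF functor_eq_sym[OF Pi1_map_comp[OF X Y Z maps(1,2)]]]
    Pi1_map_comp[OF X Y' Z maps(3,4)]
  unfolding square .


section \<open>The comparison functors\<close>

lemma graph_map_boxI:
  assumes X: "simple_graph X" and Y: "simple_graph Y"
    and verts: "\<And>x y. x \<in> verts X \<Longrightarrow> y \<in> verts Y \<Longrightarrow> f (x, y) \<in> verts Z"
    and left: "\<And>x x' y. adj X x x' \<Longrightarrow> x \<in> verts X \<Longrightarrow> x' \<in> verts X \<Longrightarrow> y \<in> verts Y \<Longrightarrow>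
      f (x, y) = f (x', y) \<or> adj Z (f (x, y)) (f (x', y))"
    and right: "\<And>x y y'. adj Y y y' \<Longrightarrow> x \<in> verts X \<Longrightarrow> y \<in> verts Y \<Longrightarrow> y' \<in> verts Y \<Longrightarrow>
      f (x, y) = f (x, y') \<or> adj Z (f (x, y)) (f (x, y'))"
  shows "graph_map (X \<box> Y) Z (restrict f (verts (X \<box> Y)))"
proof -
  have "f v = f w \<or> adj Z (f v) (f w)" if adj: "adj (X \<box> Y) v w" for v w
    using adj simple_graphD(1,2)[OF simple_graph_box[OF X Y] adj] left right
    by (cases v; cases w; simp add: adj_box verts_box) blast
  then show ?thesis
    using simple_graphD(1,2)[OF simple_graph_box[OF X Y]] verts
    by (auto simp: graph_map_def verts_box)
qed

lemma graph_map_box_fst: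
  assumes "simple_graph X" "simple_graph Y"
  shows "graph_map (X \<box> Y) X (box_fst X Y)"
  unfolding box_fst_def by (rule graph_map_boxI[OF assms]) auto

lemma graph_map_box_snd:
  assumes "simple_graph X" "simple_graph Y"
  shows "graph_map (X \<box> Y) Y (box_snd X Y)"
  unfolding box_snd_def by (rule graph_map_boxI[OF assms]) auto

lemma graph_map_box_map:
  assumes X: "simple_graph X" and Y: "simple_graph Y"
    and f: "graph_map X X' f" and g: "graph_map Y Y' g"
  shows "graph_map (X \<box> Y) (X' \<box> Y') (box_map X Y f g)"
  unfolding box_map_def
  by (rule graph_map_boxI[OF X Y])
    (use f g in \<open>auto simp: graph_map_def verts_box adj_box\<close>)

lemma graph_map_box_assoc:
  assumes "simple_graph X" "simple_graph Y" "simple_graph Z"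
  shows "graph_map ((X \<box> Y) \<box> Z) (X \<box> Y \<box> Z) (box_assoc X Y Z)"
  unfolding box_assoc_def
  by (rule graph_map_boxI[OF simple_graph_box[OF assms(1,2)] assms(3)])
    (auto simp: verts_box adj_box)

lemma fobj_Psi: "v \<in> verts (X \<box> Y) \<Longrightarrow> fobj (Psi X Y) v = v"
  by (simp add: Psi_def functor_pair_def fobj_Pi1_map box_fst_def box_snd_def)

lemma fobj_Phi: "fobj (Phi X Y) v = v"
  by (simp add: Phi_def)

lemma farr_Psi:
  assumes X: "simple_graph X" and Y: "simple_graph Y"
    and p: "p \<in> paths (X \<box> Y) (x, y) (x', y')"
  shows "farr (Psi X Y) (x, y) (x', y') (path_class (X \<box> Y) (x, y) (x', y') p) =
    (path_class X x x' (path_map fst p), path_class Y y y' (path_map snd p))"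
  using farr_Pi1_map_restrict[OF simple_graph_box[OF X Y] X _ p, of fst]
    farr_Pi1_map_restrict[OF simple_graph_box[OF X Y] Y _ p, of snd]
    graph_map_box_fst[OF X Y] graph_map_box_snd[OF X Y]
  by (simp add: Psi_def functor_pair_def box_fst_def box_snd_def)

lemma Ob_gpd_prod: "Ob (G \<times>\<^sub>G H) = Ob G \<times> Ob H"
  by (simp add: gpd_prod_def)

lemma Hom_Pi1_prodE:
  assumes "a \<in> Hom (Pi1 X \<times>\<^sub>G Pi1 Y) (x, y) (x', y')"
  obtains p q where "p \<in> paths X x x'" "q \<in> paths Y y y'"
    "a = (path_class X x x' p, path_class Y y y' q)"
  using assms by (auto simp: gpd_prod_def elim!: Hom_Pi1E)

lemma is_functor_Psi:
  assumes X: "simple_graph X" and Y: "simple_graph Y"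
  shows "is_functor (Pi1 (X \<box> Y)) (Pi1 X \<times>\<^sub>G Pi1 Y) (Psi X Y)"
  unfolding Psi_def
  by (intro is_functor_pair is_functor_Pi1_map simple_graph_box graph_map_box_fst graph_map_box_snd
      X Y)

lemma farr_Phi_concat:
  assumes X: "simple_graph X" and Y: "simple_graph Y"
    and p: "p \<in> paths X x x'" "p' \<in> paths X x' x''"
    and q: "q \<in> paths Y y y'" "q' \<in> paths Y y' y''"
  shows "farr (Phi X Y) (x, y) (x'', y'')
      (path_class X x x'' (p \<star> p'), path_class Y y y'' (q \<star> q')) =
    Comp (Pi1 (X \<box> Y)) (x, y) (x', y') (x'', y'')
      (farr (Phi X Y) (x', y') (x'', y'') (path_class X x' x'' p', path_class Y y' y'' q'))
      (farr (Phi X Y) (x, y) (x', y') (path_class X x x' p, path_class Y y y' q))"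
  unfolding farr_Phi[OF X Y p(1) q(1)] farr_Phi[OF X Y p(2) q(2)]
    farr_Phi[OF X Y path_concat_in_paths[OF X p] path_concat_in_paths[OF Y q]]
    Comp_Pi1[OF simple_graph_box[OF X Y] path_box_in_paths[OF X Y p(1) q(1)]
      path_box_in_paths[OF X Y p(2) q(2)]]
  by (rule path_class_eqI_homotopic[OF path_homotopic_box_concat[OF X Y p q]])

lemma is_functor_Phi:
  assumes X: "simple_graph X" and Y: "simple_graph Y"
  shows "is_functor (Pi1 X \<times>\<^sub>G Pi1 Y) (Pi1 (X \<box> Y)) (Phi X Y)"
  unfolding is_functor_def Ob_gpd_prod Ob_Pi1 fobj_Phi split_paired_Ball_Sigma
proof (intro conjI ballI; (elim Hom_Pi1_prodE)?)
  note XY = simple_graph_box[OF X Y]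
  fix x y assume x: "x \<in> verts X" and y: "y \<in> verts Y"
  then show "(x, y) \<in> verts (X \<box> Y)" by (simp add: verts_box)
  then have "path_stall 0 (x, y) \<in> paths (X \<box> Y) (x, y) (x, y)"
    by (rule path_stall_in_paths[OF XY])
  then show "farr (Phi X Y) (x, y) (x, y) (Ident (Pi1 X \<times>\<^sub>G Pi1 Y) (x, y)) =
      Ident (Pi1 (X \<box> Y)) (x, y)"
    using farr_Phi[OF X Y path_stall_in_paths[OF X x] path_stall_in_paths[OF Y y]]
    by (simp add: gpd_prod_def Ident_Pi1 path_const_eq_stall path_box_left_stall
        path_box_right_stall path_stall_0_concat[OF XY])
next
  fix x y x' y' a p q
  assume p: "p \<in> paths X x x'" and q: "q \<in> paths Y y y'"
    and a: "a = (path_class X x x' p, path_class Y y y' q)"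
  show "farr (Phi X Y) (x, y) (x', y') a \<in> Hom (Pi1 (X \<box> Y)) (x, y) (x', y')"
    unfolding a farr_Phi[OF X Y p q] by (rule path_class_in_Hom[OF path_box_in_paths[OF X Y p q]])
next
  fix x y x' y' x'' y'' a b p q p' q'
  assume p: "p \<in> paths X x x'" "p' \<in> paths X x' x''"
    and q: "q \<in> paths Y y y'" "q' \<in> paths Y y' y''"
    and ab: "a = (path_class X x x' p, path_class Y y y' q)"
      "b = (path_class X x' x'' p', path_class Y y' y'' q')"
  show "farr (Phi X Y) (x, y) (x'', y'')
        (Comp (Pi1 X \<times>\<^sub>G Pi1 Y) (x, y) (x', y') (x'', y'') b a) =
      Comp (Pi1 (X \<box> Y)) (x, y) (x', y') (x'', y'')
        (farr (Phi X Y) (x', y') (x'', y'') b) (farr (Phi X Y) (x, y) (x', y') a)"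
    using farr_Phi_concat[OF X Y p q]
    by (simp add: ab gpd_prod_def Comp_Pi1[OF X p] Comp_Pi1[OF Y q])
qed

lemma Psi_comp_Phi:
  assumes X: "simple_graph X" and Y: "simple_graph Y"
  shows "functor_eq (Pi1 X \<times>\<^sub>G Pi1 Y) (Psi X Y \<circ>\<^sub>F Phi X Y) functor_id"
  unfolding functor_eq_def Ob_gpd_prod Ob_Pi1 split_paired_Ball_Sigma
proof (intro conjI ballI; (elim Hom_Pi1_prodE)?)
  fix x y x' y' a p q
  assume p: "p \<in> paths X x x'" and q: "q \<in> paths Y y y'"
    and a: "a = (path_class X x x' p, path_class Y y y' q)"
  show "farr (Psi X Y \<circ>\<^sub>F Phi X Y) (x, y) (x', y') a = farr functor_id (x, y) (x', y') a"
    using path_class_eqI_homotopic[OF path_homotopic_concat_stall[OF X p]]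
      path_class_eqI_homotopic[OF path_homotopic_stall_concat[OF Y q]]
    by (simp add: a functor_comp_def functor_id_def fobj_Phi farr_Phi[OF X Y p q]
        farr_Psi[OF X Y path_box_in_paths[OF X Y p q]] path_map_fst_box[OF X p]
        path_map_snd_box[OF Y q])
qed (simp add: functor_comp_def functor_id_def fobj_Phi fobj_Psi verts_box)

lemma Phi_comp_Psi:
  assumes X: "simple_graph X" and Y: "simple_graph Y"
  shows "functor_eq (Pi1 (X \<box> Y)) (Phi X Y \<circ>\<^sub>F Psi X Y) functor_id"
proof (rule functor_eq_Pi1I_on_edges[OF simple_graph_box[OF X Y]
      is_functor_comp[OF is_functor_Phi[OF X Y] is_functor_Psi[OF X Y]] is_functor_id])
  fix v assume "v \<in> verts (X \<box> Y)"
  then show "fobj (Phi X Y \<circ>\<^sub>F Psi X Y) v = fobj functor_id v"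
    by (simp add: functor_comp_def functor_id_def fobj_Phi fobj_Psi)
next
  note XY = simple_graph_box[OF X Y]
  fix v w assume adj: "adj (X \<box> Y) v w"
  obtain x y x' y' where vw: "v = (x, y)" "w = (x', y')" by (cases v, cases w)
  note vw_verts = simple_graphD(1,2)[OF XY adj]
  have ends: "x \<in> verts X" "x' \<in> verts X" "x = x' \<or> adj X x x'"
      "y \<in> verts Y" "y' \<in> verts Y" "y = y' \<or> adj Y y y'"
    using adj vw_verts by (auto simp: vw adj_box verts_box)
  note edge = path_edge_in_paths[OF XY vw_verts disjI2[OF adj], unfolded vw]
  show "farr (Phi X Y \<circ>\<^sub>F Psi X Y) v w (path_class (X \<box> Y) v w (path_edge v w)) =
      farr functor_id v w (path_class (X \<box> Y) v w (path_edge v w))"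
    using path_class_eqI_homotopic[OF path_homotopic_box_edge[OF X Y adj[unfolded vw]]] vw_verts
      farr_Phi[OF X Y path_edge_in_paths[OF X ends(1-3)] path_edge_in_paths[OF Y ends(4-6)]]
    by (simp add: vw functor_comp_def functor_id_def fobj_Psi farr_Psi[OF X Y edge] path_map_edge)
qed

lemma inverse_functors_Psi_Phi:
  "simple_graph X \<Longrightarrow> simple_graph Y \<Longrightarrow>
    inverse_functors (Pi1 (X \<box> Y)) (Pi1 X \<times>\<^sub>G Pi1 Y) (Psi X Y) (Phi X Y)"
  by (simp add: inverse_functors_def is_functor_Psi is_functor_Phi Phi_comp_Psi Psi_comp_Phi)

lemma Hom_Pi1_interval_0: "Hom (Pi1 (interval 0)) 0 0 = {Ident (Pi1 (interval 0)) 0}"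
proof -
  note I = simple_graph_interval[of 0]
  have "path_class (interval 0) 0 0 p = Ident (Pi1 (interval 0)) 0"
    if p: "p \<in> paths (interval 0) 0 0" for p
  proof -
    have "p = path_stall (fst p) 0"
      by (rule path_eqI[OF I p path_stall_in_paths[OF I]])
        (use p in \<open>auto simp: path_stall_def paths_iff[OF I]\<close>)
    then show ?thesis
      using path_class_eqI_homotopic[OF path_homotopic_stall[OF I, of 0 "fst p" 0]]
      by (simp add: Ident_Pi1 path_const_eq_stall)
  qed
  moreover have "Ident (Pi1 (interval 0)) 0 \<in> Hom (Pi1 (interval 0)) 0 0"
    unfolding Ident_Pi1 by (rule path_class_in_Hom[OF path_const_in_paths[OF I]]) simp
  ultimately show ?thesis unfolding Hom_Pi1 by blast
qed

lemma functor_iso_Pi1_unit: "functor_iso gpd_unit (Pi1 (interval 0)) Pi1_unit"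
proof -
  let ?I = "Pi1 (interval 0)"
  have "Comp ?I 0 0 0 (Ident ?I 0) (Ident ?I 0) = Ident ?I 0" and "Ob ?I = {0}"
    using groupoid_Pi1[OF simple_graph_interval[of 0]] by (auto simp: groupoid_def Ob_Pi1)
  then have "inverse_functors gpd_unit ?I Pi1_unit \<lparr>fobj = (\<lambda>_. ()), farr = (\<lambda>_ _ _. ())\<rparr>"
    by (simp add: inverse_functors_def is_functor_def functor_eq_def functor_comp_def
        functor_id_def Pi1_unit_def gpd_unit_def Hom_Pi1_interval_0)
  then show ?thesis unfolding functor_iso_def by blast
qed


section \<open>Naturality and coherence\<close>

lemma Psi_natural:
  assumes X: "simple_graph X" and X': "simple_graph X'" and Y: "simple_graph Y"
    and Y': "simple_graph Y'" and f: "graph_map X X' f" and g: "graph_map Y Y' g"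
  shows "functor_eq (Pi1 (X \<box> Y)) (Psi X' Y' \<circ>\<^sub>F Pi1_map (X' \<box> Y') (box_map X Y f g))
    ((Pi1_map X' f \<times>\<^sub>F Pi1_map Y' g) \<circ>\<^sub>F Psi X Y)"
  unfolding Psi_def functor_pair_comp functor_prod_comp_pair
proof (rule functor_eq_pair)
  note XY = simple_graph_box[OF X Y] and XY' = simple_graph_box[OF X' Y']
    and box_map = graph_map_box_map[OF X Y f g]
  show "functor_eq (Pi1 (X \<box> Y))
      (Pi1_map X' (box_fst X' Y') \<circ>\<^sub>F Pi1_map (X' \<box> Y') (box_map X Y f g))
      (Pi1_map X' f \<circ>\<^sub>F Pi1_map X (box_fst X Y))"
    by (rule Pi1_map_square[OF XY XY' X X' box_map graph_map_box_fst[OF X' Y']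
          graph_map_box_fst[OF X Y] f])
      (use graph_map_verts[OF f] graph_map_verts[OF g] in
        \<open>auto simp: fun_eq_iff graph_comp_def compose_def box_map_def box_fst_def verts_box\<close>)
  show "functor_eq (Pi1 (X \<box> Y))
      (Pi1_map Y' (box_snd X' Y') \<circ>\<^sub>F Pi1_map (X' \<box> Y') (box_map X Y f g))
      (Pi1_map Y' g \<circ>\<^sub>F Pi1_map Y (box_snd X Y))"
    by (rule Pi1_map_square[OF XY XY' Y Y' box_map graph_map_box_snd[OF X' Y']
          graph_map_box_snd[OF X Y] g])
      (use graph_map_verts[OF f] graph_map_verts[OF g] in
        \<open>auto simp: fun_eq_iff graph_comp_def compose_def box_map_def box_snd_def verts_box\<close>)
qed

lemma Phi_natural:
  assumes X: "simple_graph X" and X': "simple_graph X'" and Y: "simple_graph Y"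
    and Y': "simple_graph Y'" and f: "graph_map X X' f" and g: "graph_map Y Y' g"
  shows "functor_eq (Pi1 X \<times>\<^sub>G Pi1 Y)
    (Pi1_map (X' \<box> Y') (box_map X Y f g) \<circ>\<^sub>F Phi X Y)
    (Phi X' Y' \<circ>\<^sub>F (Pi1_map X' f \<times>\<^sub>F Pi1_map Y' g))"
  by (rule inverse_functors_square[OF inverse_functors_Psi_Phi[OF X Y]
        inverse_functors_Psi_Phi[OF X' Y'] _ Psi_natural[OF assms]])
    (intro is_functor_Pi1_map simple_graph_box graph_map_box_map assms)

text \<open>Up to reassociation, projecting to \<open>Y \<box> Z\<close> is \<open>box_snd X Y \<box> Z\<close>, so this is an instance
  of naturality.\<close>

lemma Psi_comp_box_snd_assoc:
  assumes X: "simple_graph X" and Y: "simple_graph Y" and Z: "simple_graph Z"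
  shows "functor_eq (Pi1 ((X \<box> Y) \<box> Z))
    (Psi Y Z \<circ>\<^sub>F Pi1_map (Y \<box> Z) (box_snd X (Y \<box> Z)) \<circ>\<^sub>F
      Pi1_map (X \<box> Y \<box> Z) (box_assoc X Y Z))
    ((Pi1_map Y (box_snd X Y) \<times>\<^sub>F functor_id) \<circ>\<^sub>F Psi (X \<box> Y) Z)"
proof -
  let ?W = "(X \<box> Y) \<box> Z"
  let ?snd_id = "box_map (X \<box> Y) Z (box_snd X Y) (graph_id Z)"
  note XY = simple_graph_box[OF X Y] and YZ = simple_graph_box[OF Y Z]
  have "graph_comp ?W (box_snd X (Y \<box> Z)) (box_assoc X Y Z) = ?snd_id"
    by (auto simp: fun_eq_iff graph_comp_def compose_def box_assoc_def box_snd_def box_map_def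
        graph_id_def verts_box)
  then have "functor_eq (Pi1 ?W)
      (Pi1_map (Y \<box> Z) (box_snd X (Y \<box> Z)) \<circ>\<^sub>F Pi1_map (X \<box> Y \<box> Z) (box_assoc X Y Z))
      (Pi1_map (Y \<box> Z) ?snd_id)"
    using Pi1_map_comp[OF simple_graph_box[OF XY Z] simple_graph_box[OF X YZ] YZ
        graph_map_box_assoc[OF X Y Z] graph_map_box_snd[OF X YZ]]
    by (simp add: functor_eq_sym)
  then have "functor_eq (Pi1 ?W)
      (Psi Y Z \<circ>\<^sub>F Pi1_map (Y \<box> Z) (box_snd X (Y \<box> Z)) \<circ>\<^sub>F
        Pi1_map (X \<box> Y \<box> Z) (box_assoc X Y Z))
      (Psi Y Z \<circ>\<^sub>F Pi1_map (Y \<box> Z) ?snd_id)"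
    by (rule functor_eq_comp_left)
  also have "functor_eq (Pi1 ?W) \<dots>
      ((Pi1_map Y (box_snd X Y) \<times>\<^sub>F Pi1_map Z (graph_id Z)) \<circ>\<^sub>F Psi (X \<box> Y) Z)"
    by (rule Psi_natural[OF XY Y Z Z graph_map_box_snd[OF X Y] graph_map_id[OF Z]])
  also have "functor_eq (Pi1 ?W) \<dots>
      ((Pi1_map Y (box_snd X Y) \<times>\<^sub>F functor_id) \<circ>\<^sub>F Psi (X \<box> Y) Z)"
    by (rule functor_eq_comp_right[OF functor_eq_prod[OF functor_eq_refl Pi1_map_id[OF Z]]
          is_functor_Psi[OF XY Z]])
  finally show ?thesis .
qed

lemma Psi_assoc:
  assumes X: "simple_graph X" and Y: "simple_graph Y" and Z: "simple_graph Z"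
  shows "functor_eq (Pi1 ((X \<box> Y) \<box> Z))
    (((functor_id \<times>\<^sub>F Psi Y Z) \<circ>\<^sub>F Psi X (Y \<box> Z)) \<circ>\<^sub>F Pi1_map (X \<box> Y \<box> Z) (box_assoc X Y Z))
    (gpd_assoc \<circ>\<^sub>F (Psi X Y \<times>\<^sub>F functor_id) \<circ>\<^sub>F Psi (X \<box> Y) Z)"
proof -
  note XY = simple_graph_box[OF X Y] and YZ = simple_graph_box[OF Y Z]
  have "functor_eq (Pi1 ((X \<box> Y) \<box> Z))
      (Pi1_map X (box_fst X (Y \<box> Z)) \<circ>\<^sub>F Pi1_map (X \<box> Y \<box> Z) (box_assoc X Y Z))
      (Pi1_map X (box_fst X Y) \<circ>\<^sub>F Pi1_map (X \<box> Y) (box_fst (X \<box> Y) Z))"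
    by (rule Pi1_map_square[OF simple_graph_box[OF XY Z] simple_graph_box[OF X YZ] XY X
          graph_map_box_assoc[OF X Y Z] graph_map_box_fst[OF X YZ] graph_map_box_fst[OF XY Z]
          graph_map_box_fst[OF X Y]])
      (auto simp: fun_eq_iff graph_comp_def compose_def box_assoc_def box_fst_def verts_box)
  then show ?thesis
    using Psi_comp_box_snd_assoc[OF X Y Z]
    unfolding Psi_def[of X] Psi_def[of "X \<box> Y"] functor_prod_comp_pair functor_pair_comp
      functor_comp_id_left gpd_assoc_comp_pair functor_comp_assoc
    by (rule functor_eq_pair)
qed

lemma Phi_assoc:
  assumes X: "simple_graph X" and Y: "simple_graph Y" and Z: "simple_graph Z"
  shows "functor_eq ((Pi1 X \<times>\<^sub>G Pi1 Y) \<times>\<^sub>G Pi1 Z)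
    (Pi1_map (X \<box> Y \<box> Z) (box_assoc X Y Z) \<circ>\<^sub>F Phi (X \<box> Y) Z \<circ>\<^sub>F (Phi X Y \<times>\<^sub>F functor_id))
    (Phi X (Y \<box> Z) \<circ>\<^sub>F (functor_id \<times>\<^sub>F Phi Y Z) \<circ>\<^sub>F gpd_assoc)"
proof -
  note XY = simple_graph_box[OF X Y] and YZ = simple_graph_box[OF Y Z]
  note left = inverse_functors_comp[OF inverse_functors_Psi_Phi[OF XY Z]
      inverse_functors_prod[OF inverse_functors_Psi_Phi[OF X Y] inverse_functors_id]]
    and right = inverse_functors_comp[OF inverse_functors_Psi_Phi[OF X YZ]
      inverse_functors_prod[OF inverse_functors_id inverse_functors_Psi_Phi[OF Y Z]]]
  show ?thesis
    using inverse_functors_square[OF left right is_functor_Pi1_map[OF simple_graph_box[OF XY Z]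
          simple_graph_box[OF X YZ] graph_map_box_assoc[OF X Y Z]]] Psi_assoc[OF X Y Z]
    by (simp add: functor_comp_assoc)
qed

lemma is_functor_Pi1_unit: "is_functor gpd_unit (Pi1 (interval 0)) Pi1_unit"
  using functor_iso_Pi1_unit by (auto simp: functor_iso_def inverse_functors_def)

lemma Pi1_fst_comp_Phi:
  assumes "simple_graph X" "simple_graph Y"
  shows "functor_eq (Pi1 X \<times>\<^sub>G Pi1 Y) (Pi1_map X (box_fst X Y) \<circ>\<^sub>F Phi X Y) functor_fst"
  using Psi_comp_Phi[OF assms]
  by (simp add: functor_eq_def Psi_def functor_pair_def functor_comp_def functor_id_def
      functor_fst_def prod_eq_iff)

lemma Pi1_snd_comp_Phi:
  assumes "simple_graph X" "simple_graph Y"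
  shows "functor_eq (Pi1 X \<times>\<^sub>G Pi1 Y) (Pi1_map Y (box_snd X Y) \<circ>\<^sub>F Phi X Y) functor_snd"
  using Psi_comp_Phi[OF assms]
  by (simp add: functor_eq_def Psi_def functor_pair_def functor_comp_def functor_id_def
      functor_snd_def prod_eq_iff)

lemma Phi_lunit:
  assumes X: "simple_graph X"
  shows "functor_eq (gpd_unit \<times>\<^sub>G Pi1 X)
    (Pi1_map X (box_lunit X) \<circ>\<^sub>F Phi (interval 0) X \<circ>\<^sub>F (Pi1_unit \<times>\<^sub>F functor_id)) gpd_lunit"
proof -
  have "box_lunit X = box_snd (interval 0) X"
    by (simp add: box_lunit_def box_snd_def)
  then show ?thesis
    using functor_eq_comp_right[OF Pi1_snd_comp_Phi[OF simple_graph_interval X]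
        is_functor_prod[OF is_functor_Pi1_unit is_functor_id]]
    by (simp only: functor_comp_assoc functor_snd_comp_unit_prod)
qed

lemma Phi_runit:
  assumes X: "simple_graph X"
  shows "functor_eq (Pi1 X \<times>\<^sub>G gpd_unit)
    (Pi1_map X (box_runit X) \<circ>\<^sub>F Phi X (interval 0) \<circ>\<^sub>F (functor_id \<times>\<^sub>F Pi1_unit)) gpd_runit"
proof -
  have "box_runit X = box_fst X (interval 0)"
    by (simp add: box_runit_def box_fst_def)
  then show ?thesis
    using functor_eq_comp_right[OF Pi1_fst_comp_Phi[OF X simple_graph_interval]
        is_functor_prod[OF is_functor_id is_functor_Pi1_unit]]
    by (simp only: functor_comp_assoc functor_fst_comp_prod_unit)
qed

theorem theorem3p10:
  fixes X :: "'a pregraph" and X' :: "'b pregraph" and X'' :: "'c pregraph"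
    and Y :: "'d pregraph" and Y' :: "'e pregraph" and Z :: "'f pregraph"
  assumes "simple_graph X" and "simple_graph X'" and "simple_graph X''"
    and "simple_graph Y" and "simple_graph Y'" and "simple_graph Z"
  shows
    \<comment> \<open>\<open>\<Pi>\<^sub>1\<close> is a functor from graphs to groupoids\<close>
    "groupoid (Pi1 X) \<and>
     (\<forall>f. graph_map X X' f \<longrightarrow> is_functor (Pi1 X) (Pi1 X') (Pi1_map X' f)) \<and>
     functor_eq (Pi1 X) (Pi1_map X (graph_id X)) functor_id \<and>
     (\<forall>f g. graph_map X X' f \<longrightarrow> graph_map X' X'' g \<longrightarrow>
        functor_eq (Pi1 X) (Pi1_map X'' (graph_comp X g f)) (Pi1_map X'' g \<circ>\<^sub>F Pi1_map X' f)) \<and>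
     \<comment> \<open>the structure functors are mutually inverse, and the identity on objects\<close>
     inverse_functors (Pi1 (X \<box> Y)) (Pi1 X \<times>\<^sub>G Pi1 Y) (Psi X Y) (Phi X Y) \<and>
     Ob (Pi1 (X \<box> Y)) = Ob (Pi1 X \<times>\<^sub>G Pi1 Y) \<and>
     (\<forall>v\<in>Ob (Pi1 (X \<box> Y)). fobj (Psi X Y) v = v \<and> fobj (Phi X Y) v = v) \<and>
     functor_iso gpd_unit (Pi1 (interval 0)) Pi1_unit \<and>
     \<comment> \<open>naturality\<close>
     (\<forall>f g. graph_map X X' f \<longrightarrow> graph_map Y Y' g \<longrightarrow>
        functor_eq (Pi1 X \<times>\<^sub>G Pi1 Y)
          (Pi1_map (X' \<box> Y') (box_map X Y f g) \<circ>\<^sub>F Phi X Y)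
          (Phi X' Y' \<circ>\<^sub>F (Pi1_map X' f \<times>\<^sub>F Pi1_map Y' g))) \<and>
     \<comment> \<open>associativity and unit coherence\<close>
     functor_eq ((Pi1 X \<times>\<^sub>G Pi1 Y) \<times>\<^sub>G Pi1 Z)
       (Pi1_map (X \<box> (Y \<box> Z)) (box_assoc X Y Z) \<circ>\<^sub>F Phi (X \<box> Y) Z \<circ>\<^sub>F (Phi X Y \<times>\<^sub>F functor_id))
       (Phi X (Y \<box> Z) \<circ>\<^sub>F (functor_id \<times>\<^sub>F Phi Y Z) \<circ>\<^sub>F gpd_assoc) \<and>
     functor_eq (gpd_unit \<times>\<^sub>G Pi1 X)
       (Pi1_map X (box_lunit X) \<circ>\<^sub>F Phi (interval 0) X \<circ>\<^sub>F (Pi1_unit \<times>\<^sub>F functor_id))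
       gpd_lunit \<and>
     functor_eq (Pi1 X \<times>\<^sub>G gpd_unit)
       (Pi1_map X (box_runit X) \<circ>\<^sub>F Phi X (interval 0) \<circ>\<^sub>F (functor_id \<times>\<^sub>F Pi1_unit))
       gpd_runit"
proof (intro conjI allI impI ballI)
  show "Ob (Pi1 (X \<box> Y)) = Ob (Pi1 X \<times>\<^sub>G Pi1 Y)"
    by (simp add: Ob_Pi1 Ob_gpd_prod verts_box)
  fix v assume "v \<in> Ob (Pi1 (X \<box> Y))"
  then show "fobj (Psi X Y) v = v" by (simp add: Ob_Pi1 fobj_Psi)
qed (intro assms groupoid_Pi1 is_functor_Pi1_map Pi1_map_id Pi1_map_comp inverse_functors_Psi_Phi
    fobj_Phi functor_iso_Pi1_unit Phi_natural Phi_assoc Phi_lunit Phi_runit; assumption)+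

end
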